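(* Let $z\sim\mathcal D=\mathcal N(0,I_d)$, $x^*\in\mathbb{S}^{d-1}$, $t\in\mathbb{R}$, and $y=\operatorname{sign}(x^*\cdot z+t)$. Let $\mathcal H_+$ be the class of functions $h:\mathbb{R}\to\mathbb{R}$ that are locally Lipschitz, satisfy $h'(s)+h'(-s)>0$ for a.e. $s>0$, and satisfy, for every $a\in\mathbb{R}$, $\mathbb{E}_{s\sim\mathcal N(0,1)}[|h(a+s)|+|h'(a+s)|]<\infty$. Then, for any $h\in\mathcal H_+$, the loss $f_h(x)=\mathbb{E}_{z\sim\mathcal D}[h(-y(x\cdot z+t))]$ is $1$-RGA at $(x,x^* )$ for every $x\in\mathbb{S}^{d-1}$ with $\theta(x,x^* )\in(0,\pi/2)$.
   Context: $\mathbb{S}^{d-1}$ is the unit sphere of $\mathbb{R}^d$; $\theta(x,y)=\arccos(x\cdot y)$ for unit vectors. For a locally Lipschitz $f$, $\partial^Cf(x)$ is the Clarke subdifferential (convex hull of limits of gradients at differentiability points $y_k\to x$) and $\partial^{C,R}f(x)=\{(I-xx^\top)\xi:\xi\in\partial^Cf(x)\}$. $f$ is $\mu$-RGA at $(x,x^* )$ if every $g(x)\in\partial^{C,R}f(x)$ satisfies: $g(x)\neq0$ whenever $x\ne x^*$, and $g(x)\cdot x^*\le-\mu\,\sin(\theta(x,x^* ))\,\|g(x)\|_2$. *)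

theory Defs
  imports "HOL-Probability.Probability"
begin

definition std_gaussian :: "(real ^ 'n) measure" where
  "std_gaussian = density lborel (\<lambda>z. ennreal (\<Prod>i\<in>UNIV. std_normal_density (z $ i)))"

definition angle :: "real ^ 'n \<Rightarrow> real ^ 'n \<Rightarrow> real" where
  "angle x y = arccos (x \<bullet> y)"

(* A function that is only defined on a set D (here: where an expectation exists) is represented
   by a total function f together with D. No definition below depends on values of f outside D. *)

definition locally_lipschitz_at ::
    "'a::metric_space set \<Rightarrow> ('a \<Rightarrow> 'b::metric_space) \<Rightarrow> 'a \<Rightarrow> bool" where
  "locally_lipschitz_at D f x \<longleftrightarrow> (\<exists>\<epsilon>>0. \<exists>L. L-lipschitz_on (D \<inter> ball x \<epsilon>) f)"

(* Convex hull of the limits of gradients; differentiability is required at interior points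
   of the domain only. For D a neighbourhood of x this is the usual Clarke subdifferential. *)
definition clarke_subdifferential ::
    "(real ^ 'n) set \<Rightarrow> (real ^ 'n \<Rightarrow> real) \<Rightarrow> real ^ 'n \<Rightarrow> (real ^ 'n) set" where
  "clarke_subdifferential D f x = convex hull
     {\<xi>. \<exists>y g. (\<forall>k::nat. y k \<in> interior D \<and> GDERIV f (y k) :> g k) \<and>
               y \<longlonglongrightarrow> x \<and> g \<longlonglongrightarrow> \<xi>}"

definition riemannian_clarke_subdifferential ::
    "(real ^ 'n) set \<Rightarrow> (real ^ 'n \<Rightarrow> real) \<Rightarrow> real ^ 'n \<Rightarrow> (real ^ 'n) set" where
  "riemannian_clarke_subdifferential D f x =
     {\<xi> - (x \<bullet> \<xi>) *\<^sub>R x | \<xi>. \<xi> \<in> clarke_subdifferential D f x}"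

(* The first two conjuncts are what the Clarke subdifferential presupposes: f is defined at x and
   Lipschitz near x, and x is approached by interior points of D. They exclude that the
   last conjunct holds only because there is no subgradient. *)
definition rga ::
    "real \<Rightarrow> (real ^ 'n) set \<Rightarrow> (real ^ 'n \<Rightarrow> real) \<Rightarrow> real ^ 'n \<Rightarrow> real ^ 'n \<Rightarrow> bool" where
  "rga \<mu> D f x xs \<longleftrightarrow>
     x \<in> D \<inter> closure (interior D) \<and>
     locally_lipschitz_at D f x \<and>
     (\<forall>g \<in> riemannian_clarke_subdifferential D f x.
        (x \<noteq> xs \<longrightarrow> g \<noteq> 0) \<and> g \<bullet> xs \<le> - \<mu> * sin (angle x xs) * norm g)"

(* Differentiability is explicit in the second condition since deriv is total; it holds almost
   everywhere anyway, h being locally Lipschitz. *)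
definition H_plus :: "(real \<Rightarrow> real) set" where
  "H_plus = {h.
     (\<forall>s. locally_lipschitz_at UNIV h s) \<and>
     (AE s in lborel. s > 0 \<longrightarrow>
        h field_differentiable at s \<and> h field_differentiable at (- s) \<and>
        deriv h s + deriv h (- s) > 0) \<and>
     (\<forall>a. integrable (density lborel (\<lambda>s. ennreal (std_normal_density s)))
            (\<lambda>s. \<bar>h (a + s)\<bar> + \<bar>deriv h (a + s)\<bar>))}"

definition label :: "real ^ 'n \<Rightarrow> real \<Rightarrow> real ^ 'n \<Rightarrow> real" where
  "label xs t z = sgn (xs \<bullet> z + t)"

(* For norm x > 1 membership of h in H_plus does not guarantee that the expectation defining
   the loss exists. *)
definition loss_domain :: "real ^ 'n \<Rightarrow> real \<Rightarrow> (real \<Rightarrow> real) \<Rightarrow> (real ^ 'n) set" where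
  "loss_domain xs t h =
     {x. integrable std_gaussian (\<lambda>z. h (- label xs t z * (x \<bullet> z + t)))}"

definition loss :: "real ^ 'n \<Rightarrow> real \<Rightarrow> (real \<Rightarrow> real) \<Rightarrow> real ^ 'n \<Rightarrow> real" where
  "loss xs t h x = (LINT z|std_gaussian. h (- label xs t z * (x \<bullet> z + t)))"

end

theory Submission
  imports Defs
begin

text \<open>Write \<open>\<phi>\<close> and \<open>\<Phi>\<close> for the standard normal density and distribution function. A point \<open>x\<close> that is not
parallel to the target \<open>xs\<close> has polar coordinates \<open>x = r (cos \<theta> xs + sin \<theta> e)\<close>, where \<open>e\<close> is a unit
vector orthogonal to \<open>xs\<close>. By rotation invariance of the Gaussian, \<open>U = x \<bullet> z / r\<close> and a second
orthonormal coordinate \<open>W\<close> are independent standard normal variables, and the label is the sign of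
\<open>cos \<theta> U + sin \<theta> W + t\<close>. Integrating over \<open>W\<close> gives
\<open>loss(x) = E[h(-v) \<Phi>(q) + h(v) \<Phi>(-q)]\<close> with \<open>v = r U + t\<close> and \<open>q = (t + cos \<theta> U) / sin \<theta>\<close>
(lemma \<open>loss_polar\<close>); thus the loss is a function \<open>F(r, \<theta>)\<close>.

The decisive identity is
\<open>\<partial>F/\<partial>\<theta> = \<phi>(t) \<integral> H(r sin \<theta> w + t (1 - r cos \<theta>)) w \<phi>(w) dw\<close> with \<open>H(u) = h(u) - h(-u)\<close>
(lemma \<open>integral_angle_deriv_eq\<close>), which comes from \<open>\<phi>(U) \<phi>(q) = \<phi>(t) \<phi>(w)\<close> for
\<open>U = sin \<theta> w - t cos \<theta>\<close>. A locally Lipschitz function with positive derivative almost everywhere is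
strictly increasing, so \<open>H\<close> is; as \<open>\<integral> w \<phi>(w) dw = 0\<close>, the integral is positive, and it is bounded
away from \<open>0\<close> locally uniformly (lemma \<open>integral_mult_normal_ge\<close>). Under the
integral, only the Gaussian kernel is differentiated, never \<open>h\<close>.

Reflections that fix \<open>xs\<close> and \<open>y\<close> leave the loss invariant, so a gradient at \<open>y\<close> lies in the plane spanned by
\<open>xs\<close> and \<open>y\<close>, and its component along the unit vector \<open>n = cos \<theta> e - sin \<theta> xs\<close> tangent to the meridian
is \<open>(1/r) \<partial>F/\<partial>\<theta> > 0\<close>. As the lower bound is uniform
near \<open>x\<close>, both properties pass to limits and convex hulls
(lemma \<open>clarke_subgradient\<close>). A Riemannian Clarke subgradient at \<open>x\<close> is therefore \<open>l n\<close> with \<open>l > 0\<close>,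
whence \<open>g \<bullet> xs = - l sin \<theta> = - sin \<theta> * norm g\<close>.

Differentiation under the integral and the Lipschitz property rest on a common majorant of the kernel and of
its two first derivatives (lemma \<open>loss_kernel_majorised\<close>). The delicate point is that the expectation may
diverge for \<open>norm x > 1\<close>, so the unit vector \<open>x\<close> may lie on the boundary of the domain. For \<open>x\<close> at an
angle less than \<open>\<pi>/2\<close> from \<open>xs\<close>, the part of the kernel in which the label disagrees with the sign of
\<open>U\<close> has Gaussian tails strictly lighter than those of \<open>U\<close>, and causes no trouble. Convergence of the
remaining part depends on \<open>r\<close> alone and is monotone in \<open>r\<close> (predicate \<open>far_integrable\<close>). Near \<open>x\<close> the
domain therefore either is the closed unit ball or contains a neighbourhood of \<open>x\<close>, and in both
cases the majorant is integrable.\<close>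

section \<open>Rotation invariance of the Gaussian measure\<close>

text \<open>By the Vitali covering theorem, an open set is a disjoint union of balls up to a null set, and an orthogonal
transformation maps balls to balls of the same radius. This argument needs no determinants and works
in every Euclidean space.\<close>

lemma emeasure_lborel_image_orthogonal_transformation:
  fixes T :: "'a::euclidean_space \<Rightarrow> 'a"
  assumes T: "orthogonal_transformation T" and S: "open S"
  shows "emeasure lborel (T ` S) = emeasure lborel S"
proof -
  define K where "K = {(a::'a, r::real). 0 < r \<and> ball a r \<subseteq> S}"
  have "\<exists>i. i \<in> K \<and> x \<in> ball (fst i) (snd i) \<and> snd i < d" if x: "x \<in> S" and d: "0 < d" for x d
  proof -
    obtain k where k: "k > 0" "ball x k \<subseteq> S"
      using S x openE by blast
    have "ball x (min k (d / 2)) \<subseteq> S"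
      using k by (meson min.cobounded1 order_trans subset_ball)
    then show ?thesis
      using d k by (intro exI[of _ "(x, min k (d / 2))"]) (auto simp: K_def)
  qed
  then obtain C where C: "countable C" "C \<subseteq> K"
      and disj: "pairwise (\<lambda>i j. disjnt (ball (fst i) (snd i)) (ball (fst j) (snd j))) C"
      and neg: "negligible (S - (\<Union>i\<in>C. ball (fst i) (snd i)))"
    by (rule Vitali_covering_theorem_balls[of S K fst snd])
  let ?B = "\<lambda>i. ball (fst i) (snd i :: real) :: 'a set"
  have disjf: "disjoint_family_on ?B C"
    using disj by (auto simp: disjoint_family_on_def pairwise_def disjnt_def)
  have sub: "(\<Union>i\<in>C. ?B i) \<subseteq> S"
    using C(2) by (auto simp: K_def subset_eq split_beta)
  have bij: "inj T"
    using T by (simp add: orthogonal_transformation_inj)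
  have disjT: "disjoint_family_on (\<lambda>i. T ` ?B i) C"
    using disjf bij unfolding disjoint_family_on_def by (metis image_Int image_empty)
  have img: "T ` ?B i = ball (T (fst i)) (snd i)" for i
    by (rule image_orthogonal_transformation_ball[OF T])
  have eqS: "emeasure lborel X = emeasure lborel (\<Union>i\<in>C. Y i)"
    if n: "negligible (X - (\<Union>i\<in>C. Y i))" and s: "(\<Union>i\<in>C. Y i) \<subseteq> X" and oX: "open X"
      and oY: "\<And>i. open (Y i)" for X :: "'a set" and Y
  proof -
    have Y: "(\<Union>i\<in>C. Y i) \<in> sets borel"
      using oY by (intro borel_open) auto
    then have "X - (\<Union>i\<in>C. Y i) \<in> sets borel"
      using borel_open[OF oX] by (rule sets.Diff[rotated])
    then have "X - (\<Union>i\<in>C. Y i) \<in> null_sets lborel"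
      using n by (simp add: negligible_iff_null_sets null_sets_def)
    then have "emeasure lborel ((\<Union>i\<in>C. Y i) \<union> (X - (\<Union>i\<in>C. Y i))) = emeasure lborel (\<Union>i\<in>C. Y i)"
      using Y by (intro emeasure_Un_null_set) simp_all
    moreover have "(\<Union>i\<in>C. Y i) \<union> (X - (\<Union>i\<in>C. Y i)) = X"
      using s by blast
    ultimately show ?thesis by simp
  qed
  have lin: "linear T"
    using T by (rule orthogonal_transformation_linear)
  have TS: "open (T ` S)"
    using S T by (intro open_surjective_linear_image[OF _ lin] orthogonal_transformation_surj)
  have "negligible (T ` (S - (\<Union>i\<in>C. ?B i)))"
    using neg lin by (intro negligible_differentiable_image_negligible linear_imp_differentiable_on) simp_all
  also have "T ` (S - (\<Union>i\<in>C. ?B i)) = T ` S - (\<Union>i\<in>C. T ` ?B i)"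
    by (simp only: image_set_diff[OF bij] image_UN)
  finally have "emeasure lborel (T ` S) = emeasure lborel (\<Union>i\<in>C. T ` ?B i)"
  proof (rule eqS)
    show "(\<Union>i\<in>C. T ` ?B i) \<subseteq> T ` S"
      using sub by blast
  qed (use TS in \<open>simp_all only: img open_ball\<close>)
  also have "\<dots> = (\<integral>\<^sup>+i. emeasure lborel (T ` ?B i) \<partial>count_space C)"
  proof (rule emeasure_UN_countable)
    show "T ` ?B i \<in> sets lborel" for i
      by (simp only: img sets_lborel borel_open open_ball)
  qed (fact C disjT)+
  also have "\<dots> = (\<integral>\<^sup>+i. emeasure lborel (?B i) \<partial>count_space C)"
  proof (rule nn_integral_cong)
    fix i assume "i \<in> space (count_space C)"
    then have "0 \<le> snd i"
      using C by (auto simp: K_def)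
    then show "emeasure lborel (T ` ?B i) = emeasure lborel (?B i)"
      by (simp only: img emeasure_ball)
  qed
  also have "\<dots> = emeasure lborel (\<Union>i\<in>C. ?B i)"
  proof (rule emeasure_UN_countable[symmetric])
    show "?B i \<in> sets lborel" for i
      by (simp only: sets_lborel borel_open open_ball)
  qed (fact C disjf)+
  also have "\<dots> = emeasure lborel S"
    by (rule eqS[OF neg sub S open_ball, symmetric])
  finally show ?thesis .
qed

lemma distr_lborel_orthogonal_transformation:
  fixes T :: "'a::euclidean_space \<Rightarrow> 'a"
  assumes T: "orthogonal_transformation T"
  shows "distr lborel borel T = lborel"
proof (rule lborel_eqI[symmetric])
  fix l u :: 'a assume lu: "\<And>b. b \<in> Basis \<Longrightarrow> l \<bullet> b \<le> u \<bullet> b"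
  have m: "T \<in> borel_measurable borel"
    using T by (intro borel_measurable_continuous_onI linear_continuous_on
      linear_conv_bounded_linear[THEN iffD1] orthogonal_transformation_linear)
  have "T -` box l u = inv T ` box l u"
    using T by (intro bij_vimage_eq_inv_image orthogonal_transformation_bij)
  then have "emeasure lborel (T -` box l u) = emeasure lborel (box l u)"
    using emeasure_lborel_image_orthogonal_transformation[OF orthogonal_transformation_inv[OF T]]
    by (simp add: open_box)
  then show "emeasure (distr lborel borel T) (box l u) = (\<Prod>b\<in>Basis. (u - l) \<bullet> b)"
    using lu m by (simp add: emeasure_distr)
qed simp

text \<open>The reflection in the hyperplane orthogonal to \<open>a - b\<close>; it exchanges \<open>a\<close> and \<open>b\<close> if they have the
same norm. For \<open>a = b\<close> it is the identity, since division by zero yields zero.\<close>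

definition reflect_swap :: "'a::euclidean_space \<Rightarrow> 'a \<Rightarrow> 'a \<Rightarrow> 'a" where
  "reflect_swap a b z = z - (2 * (z \<bullet> (a - b)) / ((a - b) \<bullet> (a - b))) *\<^sub>R (a - b)"

lemma orthogonal_transformation_reflect_swap: "orthogonal_transformation (reflect_swap a b)"
proof -
  define w where "w = a - b"
  define k where "k = 2 / (w \<bullet> w)"
  have R: "reflect_swap a b = (\<lambda>z. z - (k * (z \<bullet> w)) *\<^sub>R w)"
    by (simp add: reflect_swap_def w_def k_def fun_eq_iff)
  have "linear (\<lambda>z. z - (k * (z \<bullet> w)) *\<^sub>R w)"
    by (rule linearI)
       (simp_all add: inner_add_left distrib_left scaleR_add_left scaleR_diff_right mult.left_commute)
  moreover have "(v - (k * (v \<bullet> w)) *\<^sub>R w) \<bullet> (u - (k * (u \<bullet> w)) *\<^sub>R w) = v \<bullet> u" for v u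
  proof -
    have "(v - (k * (v \<bullet> w)) *\<^sub>R w) \<bullet> (u - (k * (u \<bullet> w)) *\<^sub>R w)
        = v \<bullet> u + k * (v \<bullet> w) * (u \<bullet> w) * (k * (w \<bullet> w) - 2)"
      by (simp add: inner_diff_left inner_diff_right inner_commute[of w u] algebra_simps)
    also have "k * (v \<bullet> w) * (u \<bullet> w) * (k * (w \<bullet> w) - 2) = 0"
      by (cases "w = 0") (simp_all add: k_def)
    finally show ?thesis by simp
  qed
  ultimately show ?thesis
    by (simp add: orthogonal_transformation_def R)
qed

lemma reflect_swap_swaps:
  assumes "norm a = norm b"
  shows "reflect_swap a b a = b"
proof (cases "a = b")
  case False
  then have n: "(a - b) \<bullet> (a - b) \<noteq> 0" by simp
  have div_eq: "2 * c / d = 1" if "d = 2 * c" "d \<noteq> 0" for c d :: real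
    using that by simp
  have e: "(a - b) \<bullet> (a - b) = 2 * (a \<bullet> (a - b))"
    using assms by (simp add: norm_eq inner_diff_left inner_diff_right inner_commute)
  have "2 * (a \<bullet> (a - b)) / ((a - b) \<bullet> (a - b)) = 1"
    using div_eq[OF e n] .
  then show ?thesis
    unfolding reflect_swap_def by (simp only: scaleR_one diff_diff_eq2 add_diff_cancel_left' add_diff_cancel)
qed (simp add: reflect_swap_def)

lemma reflect_swap_fixes:
  assumes "z \<bullet> a = z \<bullet> b"
  shows "reflect_swap a b z = z"
  using assms by (simp add: reflect_swap_def inner_diff_right)

lemma ex_orthogonal_transformation_axis_pair:
  fixes e1 e2 a1 a2 :: "'a::euclidean_space"
  assumes "norm e1 = 1" "norm e2 = 1" "e1 \<bullet> e2 = 0"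
    and "norm a1 = 1" "norm a2 = 1" "a1 \<bullet> a2 = 0"
  shows "\<exists>T. orthogonal_transformation T \<and> T a1 = e1 \<and> T a2 = e2"
proof -
  \<comment> \<open>The first reflection sends \<open>a1\<close> to \<open>e1\<close>; the second one corrects the image of \<open>a2\<close> and fixes \<open>e1\<close>,\<close>
  \<comment> \<open>which is orthogonal to both vectors that it exchanges.\<close>
  let ?R = "reflect_swap a1 e1"
  let ?S = "reflect_swap (?R a2) e2"
  have R: "orthogonal_transformation ?R" "?R a1 = e1"
    using assms by (auto simp: orthogonal_transformation_reflect_swap reflect_swap_swaps)
  have "e1 \<bullet> ?R a2 = 0" "norm (?R a2) = 1"
    using R assms by (metis orthogonal_transformation_def, metis orthogonal_transformation)
  then have "?S e1 = e1" "?S (?R a2) = e2"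
    using assms by (auto simp: reflect_swap_swaps reflect_swap_fixes)
  then show ?thesis
    using R by (intro exI[of _ "?S \<circ> ?R"])
      (auto intro: orthogonal_transformation_compose orthogonal_transformation_reflect_swap)
qed

lemma std_gaussian_density_norm:
  fixes z :: "real ^ 'n"
  shows "(\<Prod>i\<in>UNIV. std_normal_density (z $ i)) = (1 / sqrt (2 * pi)) ^ CARD('n) * exp (- (norm z)\<^sup>2 / 2)"
proof -
  have "(\<Prod>i\<in>UNIV. std_normal_density (z $ i)) = (1 / sqrt (2 * pi)) ^ CARD('n) * exp (\<Sum>i\<in>UNIV. - (z $ i)\<^sup>2 / 2)"
    by (simp add: std_normal_density_def exp_sum prod_dividef power_one_over prod_constant divide_simps)
  also have "(\<Sum>i\<in>UNIV. - (z $ i)\<^sup>2 / 2) = - (norm z)\<^sup>2 / 2"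
    by (simp add: norm_vec_def L2_set_def sum_nonneg sum_negf sum_divide_distrib)
  finally show ?thesis .
qed

lemma distr_std_gaussian_orthogonal_transformation:
  fixes T :: "real ^ 'n \<Rightarrow> real ^ 'n"
  assumes T: "orthogonal_transformation T"
  shows "distr std_gaussian borel T = std_gaussian"
proof -
  let ?g = "\<lambda>z::real^'n. ennreal (\<Prod>i\<in>UNIV. std_normal_density (z $ i))"
  have m[measurable]: "T \<in> borel_measurable borel"
    using T by (intro borel_measurable_continuous_onI linear_continuous_on
      linear_conv_bounded_linear[THEN iffD1] orthogonal_transformation_linear)
  have g[measurable]: "?g \<in> borel_measurable borel"
    by measurable
  have gT: "?g (T z) = ?g z" for z
    using T by (simp add: std_gaussian_density_norm orthogonal_transformation_norm)
  have "distr (density lborel (\<lambda>z. ?g (T z))) borel T = density (distr lborel borel T) ?g"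
    by (subst density_distr) auto
  then show ?thesis
    by (simp add: gT std_gaussian_def distr_lborel_orthogonal_transformation[OF T])
qed

lemma distr_std_gaussian_coordinates:
  fixes i j :: "'n::finite"
  assumes ij: "i \<noteq> j"
  shows "distr std_gaussian (borel \<Otimes>\<^sub>M borel) (\<lambda>z::real^'n. (z $ i, z $ j))
    = std_normal_distribution \<Otimes>\<^sub>M std_normal_distribution"
proof (rule pair_measure_eqI[symmetric])
  interpret N: prob_space std_normal_distribution
    using real_dist_normal_dist by (simp add: real_distribution_def)
  show "sigma_finite_measure std_normal_distribution" "sigma_finite_measure std_normal_distribution"
    by unfold_locales
  fix A B :: "real set"
  assume "A \<in> sets std_normal_distribution" "B \<in> sets std_normal_distribution"
  then have [measurable]: "A \<in> sets borel" "B \<in> sets borel" by auto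
  have mm: "(\<lambda>z::real^'n. (z $ i, z $ j)) \<in> borel \<rightarrow>\<^sub>M borel \<Otimes>\<^sub>M borel"
    by measurable
  have AB: "A \<times> B \<in> sets (borel \<Otimes>\<^sub>M borel)"
    by auto
  let ?f = "\<lambda>(b::real^'n) x. ennreal (std_normal_density x) *
    (if b = axis i 1 then indicator A x else 1) * (if b = axis j 1 then indicator B x else 1)"
  have axis_eq: "axis k (1::real) = axis l 1 \<longleftrightarrow> k = l" for k l :: 'n
    by (auto simp: axis_eq_axis)
  have bas: "(Basis :: (real^'n) set) = range (\<lambda>k. axis k 1)"
    by (auto simp: Basis_vec_def)
  have inj: "inj (\<lambda>k::'n. axis k (1::real))"
    by (auto simp: inj_def axis_eq)
  have "emeasure (distr std_gaussian (borel \<Otimes>\<^sub>M borel) (\<lambda>z::real^'n. (z $ i, z $ j))) (A \<times> B)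
      = (\<integral>\<^sup>+z. ennreal (\<Prod>k\<in>UNIV. std_normal_density (z $ k)) * (indicator A (z $ i) * indicator B (z $ j))
          \<partial>(lborel :: (real^'n) measure))"
    unfolding std_gaussian_def
    using measurable_sets[OF mm AB]
    by (subst emeasure_distr, simp_all, subst emeasure_density)
       (auto intro!: nn_integral_cong simp: indicator_def AB)
  also have "\<dots> = (\<integral>\<^sup>+z. (\<Prod>b\<in>Basis. ?f b (z \<bullet> b)) \<partial>(lborel :: (real^'n) measure))"
  proof (intro nn_integral_cong)
    fix z :: "real^'n"
    have za: "z \<bullet> axis k 1 = z $ k" for k
      by (simp add: inner_axis)
    have "(\<Prod>b\<in>Basis. ?f b (z \<bullet> b)) = (\<Prod>k\<in>UNIV. ?f (axis k 1) (z $ k))"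
      unfolding bas by (subst prod.reindex[OF inj]) (simp only: o_def za)
    also have "\<dots> = (\<Prod>k\<in>UNIV. ennreal (std_normal_density (z $ k))) *
        (\<Prod>k\<in>UNIV. (if k = i then indicator A (z $ k) else 1)) *
        (\<Prod>k\<in>UNIV. (if k = j then indicator B (z $ k) else 1))"
      by (simp add: prod.distrib axis_eq)
    also have "\<dots> = ennreal (\<Prod>k\<in>UNIV. std_normal_density (z $ k)) * (indicator A (z $ i) * indicator B (z $ j))"
      by (simp add: prod.delta prod_ennreal mult.assoc)
    finally show "ennreal (\<Prod>k\<in>UNIV. std_normal_density (z $ k)) * (indicator A (z $ i) * indicator B (z $ j))
        = (\<Prod>b\<in>Basis. ?f b (z \<bullet> b))" ..
  qed
  also have "\<dots> = (\<Prod>b\<in>Basis. (\<integral>\<^sup>+x. ?f b x \<partial>lborel))"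
    by (rule nn_integral_lborel_prod) auto
  also have "\<dots> = (\<Prod>k\<in>UNIV. (\<integral>\<^sup>+x. ?f (axis k 1) x \<partial>lborel))"
    unfolding bas by (subst prod.reindex[OF inj]) simp
  also have "\<dots> = (\<Prod>k\<in>UNIV. (if k = i then emeasure std_normal_distribution A else 1) *
      (if k = j then emeasure std_normal_distribution B else 1))"
  proof (rule prod.cong[OF refl])
    fix k :: 'n
    have one: "(\<integral>\<^sup>+x. ennreal (std_normal_density x) \<partial>lborel) = 1"
      using N.emeasure_space_1 by (simp add: emeasure_density)
    show "(\<integral>\<^sup>+x. ?f (axis k 1) x \<partial>lborel) = (if k = i then emeasure std_normal_distribution A else 1) *
      (if k = j then emeasure std_normal_distribution B else 1)"
      using ij by (auto simp: axis_eq emeasure_density one)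
  qed
  also have "\<dots> = emeasure std_normal_distribution A * emeasure std_normal_distribution B"
    by (simp add: prod.distrib prod.delta)
  finally show "emeasure std_normal_distribution A * emeasure std_normal_distribution B =
    emeasure (distr std_gaussian (borel \<Otimes>\<^sub>M borel) (\<lambda>z::real^'n. (z $ i, z $ j))) (A \<times> B)" ..
qed (auto intro!: sets_pair_measure_cong)

text \<open>The projections of a standard Gaussian vector to two orthonormal directions are independent standard normal
variables.\<close>

lemma distr_std_gaussian_orthonormal_pair:
  fixes e1 e2 :: "real ^ 'n"
  assumes "norm e1 = 1" "norm e2 = 1" "e1 \<bullet> e2 = 0"
  shows "distr std_gaussian (borel \<Otimes>\<^sub>M borel) (\<lambda>z. (e1 \<bullet> z, e2 \<bullet> z))
    = std_normal_distribution \<Otimes>\<^sub>M std_normal_distribution"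
proof -
  \<comment> \<open>Two orthonormal vectors exist only in dimension at least two.\<close>
  have "\<exists>i j :: 'n. i \<noteq> j"
  proof (rule ccontr)
    assume "\<not> ?thesis"
    then obtain i :: 'n where all: "\<And>k. k = i" by metis
    have U: "UNIV = {i}"
      by (rule UNIV_eq_I, unfold singleton_iff, rule all)
    have "e1 $ i * e2 $ i = 0" "\<bar>e1 $ i\<bar> = 1" "\<bar>e2 $ i\<bar> = 1"
      using assms by (auto simp: inner_vec_def norm_vec_def L2_set_def U)
    then show False by auto
  qed
  then obtain i j :: 'n where ij: "i \<noteq> j" by blast
  have "axis i (1::real) \<bullet> axis j 1 = 0"
    using ij by (simp add: inner_axis_axis)
  then obtain T :: "real^'n \<Rightarrow> real^'n"
    where T: "orthogonal_transformation T" "T (axis i 1) = e1" "T (axis j 1) = e2"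
    using ex_orthogonal_transformation_axis_pair[OF assms norm_axis_1[of i] norm_axis_1[of j]] by blast
  have m[measurable]: "T \<in> borel_measurable borel"
    using T by (intro borel_measurable_continuous_onI linear_continuous_on
      linear_conv_bounded_linear[THEN iffD1] orthogonal_transformation_linear)
  have sg[measurable_cong]: "sets (std_gaussian :: (real^'n) measure) = sets borel"
    by (simp add: std_gaussian_def)
  have eq: "e1 \<bullet> T z = z $ i" "e2 \<bullet> T z = z $ j" for z
    unfolding T(2,3)[symmetric] using T(1)
    by (simp_all add: orthogonal_transformation_def inner_axis' inner_real_def)
  have "distr std_gaussian (borel \<Otimes>\<^sub>M borel) (\<lambda>z. (e1 \<bullet> z, e2 \<bullet> z))
      = distr (distr std_gaussian borel T) (borel \<Otimes>\<^sub>M borel) (\<lambda>z. (e1 \<bullet> z, e2 \<bullet> z))"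
    by (simp add: distr_std_gaussian_orthogonal_transformation[OF T(1)])
  also have "\<dots> = distr std_gaussian (borel \<Otimes>\<^sub>M borel) (\<lambda>z. (z $ i, z $ j))"
    by (subst distr_distr) (auto simp: comp_def eq)
  finally show ?thesis
    by (simp add: distr_std_gaussian_coordinates[OF ij])
qed

section \<open>The standard normal distribution function\<close>

text \<open>The standard normal distribution function, as an opaque constant: the density inside \<open>cdf\<close> would
otherwise be rewritten by the simplifier.\<close>

definition Phi :: "real \<Rightarrow> real" where
  "Phi = cdf std_normal_distribution"

lemma Phi_nonneg [simp]: "0 \<le> Phi q"
  by (simp add: Phi_def cdf_def)

lemma Phi_le_1 [simp]: "Phi q \<le> 1"
  unfolding Phi_def using real_dist_normal_dist by (rule real_distribution.cdf_bounded_prob)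

lemma measure_std_normal_distribution:
  assumes [measurable]: "A \<in> sets borel"
  shows "measure std_normal_distribution A = (\<integral>x. indicator A x * std_normal_density x \<partial>lborel)"
proof -
  have "measure std_normal_distribution A = (\<integral>x. indicator A x \<partial>std_normal_distribution)"
    by simp
  also have "\<dots> = (\<integral>x. std_normal_density x * indicator A x \<partial>lborel)"
    by (subst integral_density) auto
  finally show ?thesis
    by (simp add: mult.commute)
qed

lemma has_real_derivative_Phi: "(Phi has_real_derivative std_normal_density q) (at q)"
proof -
  have cont: "continuous_on X std_normal_density" for X
    by (auto simp: normal_density_def intro!: continuous_intros)
  have eq: "Phi y = Phi (q - 1) + integral {q - 1..y} std_normal_density" if "q - 1 \<le> y" for y
  proof -
    have "Phi y - Phi (q - 1) = measure std_normal_distribution {q - 1<..y}"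
    proof (cases "q - 1 = y")
      case False
      interpret real_distribution std_normal_distribution
        by (rule real_dist_normal_dist)
      show ?thesis
        unfolding Phi_def using that False by (intro cdf_diff_eq) auto
    qed simp
    also have "\<dots> = (LINT x:{q - 1<..y}|lborel. std_normal_density x)"
      by (simp add: measure_std_normal_distribution set_lebesgue_integral_def)
    also have "\<dots> = (LINT x:{q - 1..y}|lborel. std_normal_density x)"
      unfolding set_lebesgue_integral_def
    proof (rule integral_cong_AE)
      show "AE x in lborel. indicator {q - 1<..y} x *\<^sub>R std_normal_density x = indicator {q - 1..y} x *\<^sub>R std_normal_density x"
        using AE_lborel_singleton[of "q - 1"] by eventually_elim (auto simp: indicator_def)
    qed auto
    also have "\<dots> = integral {q - 1..y} std_normal_density"
      using cont by (intro set_borel_integral_eq_integral borel_integrable_atLeastAtMost') 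
    finally show ?thesis by simp
  qed
  have "((\<lambda>y. integral {q - 1..y} std_normal_density) has_real_derivative std_normal_density q) (at q within {q - 1..q + 1})"
    by (rule integral_has_real_derivative[OF cont]) auto
  then have "((\<lambda>y. integral {q - 1..y} std_normal_density) has_real_derivative std_normal_density q) (at q)"
    by (subst (asm) at_within_Icc_at) auto
  then have "((\<lambda>y. Phi (q - 1) + integral {q - 1..y} std_normal_density) has_real_derivative std_normal_density q) (at q)"
    by (auto intro!: derivative_eq_intros)
  then show ?thesis
  proof (rule has_field_derivative_transform_within_open[where S="{q - 1<..}"])
    show "Phi (q - 1) + integral {q - 1..y} std_normal_density = Phi y" if "y \<in> {q - 1<..}" for y
      using eq[of y] that by simp
  qed auto
qed

lemmas DERIV_Phi [derivative_intros] = DERIV_chain2[OF has_real_derivative_Phi]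

lemma Phi_minus: "Phi (- q) = 1 - Phi q"
proof -
  interpret real_distribution std_normal_distribution
    by (rule real_dist_normal_dist)
  \<comment> \<open>The sum has derivative zero, and tends to 1 at infinity.\<close>
  have "DERIV (\<lambda>x. Phi x + Phi (- x)) x :> 0" for x
    by (auto intro!: derivative_eq_intros simp: normal_density_def)
  then have const: "Phi x + Phi (- x) = Phi q + Phi (- q)" for x
    by (intro DERIV_isconst_all allI)
  have "((\<lambda>x. Phi x + Phi (- x)) \<longlongrightarrow> 1 + 0) at_top"
    unfolding Phi_def
    by (intro tendsto_add cdf_lim_at_top_prob filterlim_compose[OF cdf_lim_at_bot] filterlim_uminus_at_bot_at_top)
  then have "((\<lambda>x::real. Phi q + Phi (- q)) \<longlongrightarrow> 1) at_top"
    unfolding Phi_def[symmetric]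
    by (subst (asm) const) simp
  then have "Phi q + Phi (- q) = 1"
    by (simp add: tendsto_const_iff)
  then show ?thesis by simp
qed

lemma measure_std_normal_greaterThan: "measure std_normal_distribution {- q<..} = Phi q"
proof -
  interpret real_distribution std_normal_distribution
    by (rule real_dist_normal_dist)
  have "measure std_normal_distribution (space std_normal_distribution - {.. - q}) = 1 - Phi (- q)"
    by (subst prob_compl) (auto simp: Phi_def cdf_def)
  moreover have "space std_normal_distribution - {.. - q} = {- q<..}" by auto
  ultimately show ?thesis
    by (simp add: Phi_minus)
qed

lemma measure_std_normal_singleton: "measure std_normal_distribution {q} = 0"
proof -
  interpret real_distribution std_normal_distribution
    by (rule real_dist_normal_dist)
  have "isCont Phi q"
    using has_real_derivative_Phi by (rule DERIV_isCont)
  then show ?thesis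
    by (simp add: Phi_def isCont_cdf)
qed

lemma measure_std_normal_lessThan: "measure std_normal_distribution {..<q} = Phi q"
proof -
  interpret real_distribution std_normal_distribution
    by (rule real_dist_normal_dist)
  note measure_std_normal_singleton[of q]
  moreover have "measure std_normal_distribution ({..<q} \<union> {q}) = measure std_normal_distribution {..<q} + measure std_normal_distribution {q}"
    by (intro finite_measure_Union) auto
  moreover have "{..<q} \<union> {q} = {..q}" by auto
  ultimately show ?thesis
    by (simp add: Phi_def cdf_def)
qed

lemma Phi_pos: "0 < Phi q"
proof -
  have "Phi (q - 1) < Phi q"
    by (rule DERIV_pos_imp_increasing) (auto intro!: exI[of _ "std_normal_density _"] has_real_derivative_Phi normal_density_pos)
  then show ?thesis
    using Phi_nonneg[of "q - 1"] by linarith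
qed

lemma Phi_mono: "p \<le> q \<Longrightarrow> Phi p \<le> Phi q"
  unfolding Phi_def using finite_borel_measure.cdf_nondecreasing[OF real_distribution.finite_borel_measure_M[OF real_dist_normal_dist]] .

text \<open>The Chernoff bound with a free parameter \<open>a\<close>; it holds for \<open>q\<close> of either sign.\<close>

lemma Phi_le_exp:
  assumes "0 \<le> a"
  shows "Phi q \<le> exp (a\<^sup>2 / 2 + a * q)"
proof -
  have e: "std_normal_density x * exp (a * (q - x)) = exp (a\<^sup>2 / 2 + a * q) * normal_density (- a) 1 x" for x
    by (simp add: normal_density_def power2_eq_square field_simps flip: exp_add)
  have "Phi q = (\<integral>x. indicator {..q} x * std_normal_density x \<partial>lborel)"
    by (simp add: Phi_def cdf_def measure_std_normal_distribution)
  also have "\<dots> \<le> (\<integral>x. exp (a\<^sup>2 / 2 + a * q) * normal_density (- a) 1 x \<partial>lborel)"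
  proof (rule integral_mono)
    show "integrable lborel (\<lambda>x. indicator {..q} x * std_normal_density x)"
      using integrable_mult_indicator[of "{..q}" lborel std_normal_density] by simp
    show "indicator {..q} x * std_normal_density x \<le> exp (a\<^sup>2 / 2 + a * q) * normal_density (- a) 1 x" for x
      unfolding e[symmetric] using assms mult_left_mono[of 1 "exp (a * (q - x))" "std_normal_density x"]
      by (cases "x \<le> q") auto
  qed auto
  also have "\<dots> = exp (a\<^sup>2 / 2 + a * q)"
    by simp
  finally show ?thesis .
qed

lemma borel_measurable_Phi [measurable]: "Phi \<in> borel_measurable borel"
  by (intro borel_measurable_continuous_onI continuous_at_imp_continuous_on ballI DERIV_isCont[OF has_real_derivative_Phi])

section \<open>Locally Lipschitz functions with positive derivative almost everywhere\<close>

lemma locally_lipschitz_at_imp_isCont: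
  fixes g :: "real \<Rightarrow> real"
  assumes "locally_lipschitz_at UNIV g s"
  shows "isCont g s"
proof -
  obtain e L where e: "e > 0" "L-lipschitz_on (ball s e) g"
    using assms by (auto simp: locally_lipschitz_at_def)
  then have "continuous_on (ball s e) g"
    by (blast intro: lipschitz_on_continuous_on)
  then show ?thesis
    using e by (simp add: continuous_on_eq_continuous_at)
qed

text \<open>The image of the exceptional null set under a locally Lipschitz function is null. If \<open>g p > g q\<close>
for some \<open>p < q\<close>, then some value \<open>c\<close> between \<open>g q\<close> and \<open>g p\<close> is not in that image, and at the last
point where \<open>g\<close> attains \<open>c\<close> the derivative cannot be positive. Hence \<open>g\<close> is nondecreasing; it is not
constant on any interval, because its derivative would vanish there.\<close>

lemma less_if_locally_lipschitz_deriv_pos: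
  fixes g :: "real \<Rightarrow> real"
  assumes lip: "\<And>s. locally_lipschitz_at UNIV g s"
    and pos: "AE s in lborel. 0 < s \<longrightarrow> (\<exists>D>0. (g has_real_derivative D) (at s))"
    and ab: "0 \<le> a" "a < b"
  shows "g a < g b"
proof -
  have cont: "isCont g s" for s
    using lip by (rule locally_lipschitz_at_imp_isCont)
  obtain N where N: "N \<in> null_sets lborel" "{s. \<not> (0 < s \<longrightarrow> (\<exists>D>0. (g has_real_derivative D) (at s)))} \<subseteq> N"
    using pos by (auto elim!: AE_E simp: null_sets_def)
  have negN: "negligible N"
    using N by (simp add: negligible_iff_null_sets null_sets_completionI)
  have neg: "negligible (g ` N)"
  proof (rule negligible_locally_Lipschitz_image[OF _ negN])
    fix x assume "x \<in> N"
    obtain e L where e: "e > 0" "L-lipschitz_on (ball x e) g"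
      using lip[of x] by (auto simp: locally_lipschitz_at_def)
    then show "\<exists>T B. open T \<and> x \<in> T \<and> (\<forall>y\<in>N \<inter> T. norm (g y - g x) \<le> B * norm (y - x))"
      by (intro exI[of _ "ball x e"] exI[of _ L]) (auto simp: lipschitz_on_def dist_norm)
  qed simp
  have not_int: "\<not> {l<..<u} \<subseteq> X" if "l < u" "negligible X" for l u :: real and X
  proof
    assume "{l<..<u} \<subseteq> X"
    then have "negligible (box l u)"
      using that(2) negligible_subset by (metis box_real(1))
    then show False
      using that(1) negligible_interval(2)[of l u] by simp
  qed
  have mono: "g p \<le> g q" if pq: "0 \<le> p" "p < q" for p q
  proof (rule ccontr)
    assume "\<not> g p \<le> g q"
    then have "\<not> {g q<..<g p} \<subseteq> g ` N"
      by (intro not_int neg) simp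
    then obtain c where c: "g q < c" "c < g p" "c \<notin> g ` N"
      by (metis subsetI greaterThanLessThan_iff)
    define S where "S = {u \<in> {p..q}. c \<le> g u}"
    have "closed S"
      unfolding S_def using cont
      by (intro continuous_closed_preimage_constant continuous_on_closed_Collect_le closed_Collect_conj) 
        (auto intro: continuous_at_imp_continuous_on continuous_intros)
    moreover have "p \<in> S"
      using c pq by (auto simp: S_def)
    moreover have bdd: "bdd_above S"
      by (rule bdd_aboveI[of _ q]) (simp add: S_def)
    ultimately have sS: "Sup S \<in> S"
      by (intro closed_contains_Sup) auto
    define s where "s = Sup S"
    have s: "p \<le> s" "s \<le> q" "c \<le> g s"
      using sS by (auto simp: S_def s_def)
    have after: "g u < c" if "s < u" "u \<le> q" for u
    proof (rule ccontr)
      assume "\<not> g u < c"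
      then have "u \<in> S"
        using that s by (auto simp: S_def)
      then have "u \<le> s"
        unfolding s_def using bdd by (rule cSup_upper)
      then show False using that by simp
    qed
    have sq: "s < q"
      using s c by (cases "s = q") auto
    have "\<exists>x\<ge>s. x \<le> q \<and> g x = c"
      using s c sq cont by (intro IVT2) auto
    then have gs: "g s = c"
      using after by (metis less_irrefl order_le_less)
    have "s \<noteq> p"
      using gs c by auto
    then have "0 < s"
      using s pq by auto
    then obtain D where D: "D > 0" "(g has_real_derivative D) (at s)"
      using N c gs by (auto simp: image_iff)
    then obtain d where d: "d > 0" "\<And>h. 0 < h \<Longrightarrow> h < d \<Longrightarrow> g s < g (s + h)"
      using DERIV_pos_inc_right by blast
    define k where "k = min (d / 2) (q - s)"
    have k: "0 < k" "k < d" "s + k \<le> q"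
      using d(1) sq by (auto simp: k_def)
    then have "g s < g (s + k)"
      using d(2) by blast
    then show False
      using after[of "s + k"] k gs by auto
  qed
  have "g a \<noteq> g b"
  proof
    assume eq: "g a = g b"
    have const: "g u = g a" if "a < u" "u < b" for u
      using mono[of a u] mono[of u b] that ab eq by auto
    have "\<exists>u. a < u \<and> u < b \<and> u \<notin> N"
      using not_int[OF ab(2) negN] by auto
    then obtain u where u: "a < u" "u < b" "u \<notin> N" by blast
    then have "0 < u" using ab by simp
    with u(3) obtain D where D: "D > 0" "(g has_real_derivative D) (at u)"
      using N(2) by blast
    have "(g has_real_derivative 0) (at u)"
    proof (rule has_field_derivative_transform_within_open[where S="{a<..<b}"])
      show "((\<lambda>_. g a) has_real_derivative 0) (at u)" by simp
    qed (use u const in auto)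
    then show False
      using D DERIV_unique by blast
  qed
  then show ?thesis
    using mono[of a b] ab by auto
qed

section \<open>The loss in polar coordinates\<close>

text \<open>For \<open>sin \<theta> > 0\<close>, the label at a point \<open>z\<close> with \<open>x \<bullet> z + t = v\<close>, where \<open>x\<close> has norm \<open>r\<close> and makes the angle \<open>\<theta>\<close> with \<open>xs\<close>, is
positive if and only if the second normal coordinate of \<open>z\<close> exceeds \<open>- thr t r \<theta> v\<close>.\<close>

definition thr :: "real \<Rightarrow> real \<Rightarrow> real \<Rightarrow> real \<Rightarrow> real" where
  "thr t r \<theta> v = (t + cos \<theta> * ((v - t) / r)) / sin \<theta>"

text \<open>The density of \<open>v = x \<bullet> z + t\<close> times the conditional expectation given \<open>v\<close> of the loss at \<open>z\<close>.\<close>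

definition loss_kernel :: "(real \<Rightarrow> real) \<Rightarrow> real \<Rightarrow> real \<Rightarrow> real \<Rightarrow> real \<Rightarrow> real" where
  "loss_kernel h t r \<theta> v =
     std_normal_density ((v - t) / r) / r * (h (- v) * Phi (thr t r \<theta> v) + h v * Phi (- thr t r \<theta> v))"

lemma has_bochner_integral_sgn_cut:
  fixes g :: "real \<Rightarrow> real"
  assumes s: "0 < s"
  shows "has_bochner_integral std_normal_distribution (\<lambda>w. g (- sgn (c + s * w) * v))
     (g (- v) * Phi (c / s) + g v * Phi (- (c / s)))"
proof -
  interpret real_distribution std_normal_distribution
    by (rule real_dist_normal_dist)
  let ?I = "\<lambda>A w. indicator A w :: real"
  have ind: "has_bochner_integral std_normal_distribution (?I A) (measure std_normal_distribution A)"
    if "A \<in> sets borel" for A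
    using that by (intro has_bochner_integral_real_indicator) (auto simp: emeasure_eq_measure)
  have "g (- sgn (c + s * w) * v)
     = g (- v) * ?I {- (c / s)<..} w + g v * ?I {..<- (c / s)} w + g 0 * ?I {- (c / s)} w" for w
  proof -
    consider "w > - (c / s)" | "w = - (c / s)" | "w < - (c / s)" by linarith
    then show ?thesis
    proof cases
      case 1
      then have "c + s * w > 0" using s by (simp add: field_simps)
      then show ?thesis using 1 by simp
    next
      case 2
      then show ?thesis using s by simp
    next
      case 3
      then have "c + s * w < 0" using s by (simp add: field_simps)
      then show ?thesis using 3 by simp
    qed
  qed
  then have eq: "(\<lambda>w. g (- sgn (c + s * w) * v))
     = (\<lambda>w. g (- v) * ?I {- (c / s)<..} w + g v * ?I {..<- (c / s)} w + g 0 * ?I {- (c / s)} w)"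
    by (rule ext)
  have "has_bochner_integral std_normal_distribution
      (\<lambda>w. g (- v) * ?I {- (c / s)<..} w + g v * ?I {..<- (c / s)} w + g 0 * ?I {- (c / s)} w)
      (g (- v) * measure std_normal_distribution {- (c / s)<..} +
       g v * measure std_normal_distribution {..<- (c / s)} + g 0 * measure std_normal_distribution {- (c / s)})"
    by (intro has_bochner_integral_add has_bochner_integral_mult_right ind) auto
  then show ?thesis
    unfolding eq measure_std_normal_greaterThan measure_std_normal_lessThan measure_std_normal_singleton
    by simp
qed

text \<open>The domain of the loss is described by the kernel of \<open>\<bar>h\<bar>\<close>, because the integrability of the kernel of \<open>h\<close>
itself could be due to cancellation between its two terms.\<close>

lemma loss_polar:
  fixes xs e :: "real ^ 'n"
  assumes on: "norm xs = 1" "norm e = 1" "xs \<bullet> e = 0"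
    and r: "0 < r" and s: "0 < sin \<theta>"
    and h[measurable]: "h \<in> borel_measurable borel"
    and x: "x = r *\<^sub>R (cos \<theta> *\<^sub>R xs + sin \<theta> *\<^sub>R e)"
  shows "x \<in> loss_domain xs t h \<longleftrightarrow> integrable lborel (loss_kernel (\<lambda>v. \<bar>h v\<bar>) t r \<theta>)"
    and "x \<in> loss_domain xs t h \<Longrightarrow> loss xs t h x = (\<integral>v. loss_kernel h t r \<theta> v \<partial>lborel)"
proof -
  interpret N: real_distribution std_normal_distribution
    by (rule real_dist_normal_dist)
  interpret NN: pair_sigma_finite std_normal_distribution std_normal_distribution ..
  let ?N = "std_normal_distribution"
  \<comment> \<open>An orthonormal basis of the plane whose first vector is the direction of \<open>x\<close>.\<close>
  define e1 where "e1 = cos \<theta> *\<^sub>R xs + sin \<theta> *\<^sub>R e"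
  define e2 where "e2 = sin \<theta> *\<^sub>R xs - cos \<theta> *\<^sub>R e"
  have sq: "xs \<bullet> xs = 1" "e \<bullet> e = 1" "e \<bullet> xs = 0"
    using on by (auto simp: norm_eq_1 inner_commute)
  have on': "norm e1 = 1" "norm e2 = 1" "e1 \<bullet> e2 = 0"
    using on(3) sq by (auto simp: norm_eq_1 e1_def e2_def algebra_simps inner_add_left inner_add_right
        inner_diff_left inner_diff_right simp flip: power2_eq_square)
  have xs_eq: "xs = cos \<theta> *\<^sub>R e1 + sin \<theta> *\<^sub>R e2"
  proof -
    have "cos \<theta> *\<^sub>R e1 + sin \<theta> *\<^sub>R e2 = (cos \<theta> * cos \<theta>) *\<^sub>R xs + (sin \<theta> * sin \<theta>) *\<^sub>R xs"
      by (simp add: e1_def e2_def algebra_simps)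
    also have "\<dots> = (cos \<theta> * cos \<theta> + sin \<theta> * sin \<theta>) *\<^sub>R xs"
      by (rule scaleR_add_left[symmetric])
    also have "cos \<theta> * cos \<theta> + sin \<theta> * sin \<theta> = 1"
      by (simp flip: power2_eq_square)
    finally show ?thesis by simp
  qed
  define G where "G = (\<lambda>(u, w). h (- sgn ((cos \<theta> * u + t) + sin \<theta> * w) * (r * u + t)))"
  have sgn_meas[measurable]: "(sgn :: real \<Rightarrow> real) \<in> borel_measurable borel"
  proof -
    have "sgn = (\<lambda>x::real. indicator {0<..} x - indicator {..<0} x)"
      by (auto simp: sgn_if)
    then show ?thesis by simp
  qed
  have G[measurable]: "G \<in> borel_measurable (borel \<Otimes>\<^sub>M borel)"
    unfolding G_def by measurable
  have G': "G \<in> borel_measurable (?N \<Otimes>\<^sub>M ?N)"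
    by measurable
  have integrand: "(\<lambda>z. h (- label xs t z * (x \<bullet> z + t))) = (\<lambda>z. G (e1 \<bullet> z, e2 \<bullet> z))"
  proof
    fix z
    have "xs \<bullet> z = cos \<theta> * (e1 \<bullet> z) + sin \<theta> * (e2 \<bullet> z)"
      by (subst xs_eq) (simp add: inner_add_left)
    moreover have "x \<bullet> z = r * (e1 \<bullet> z)"
      by (simp add: x e1_def)
    ultimately show "h (- label xs t z * (x \<bullet> z + t)) = G (e1 \<bullet> z, e2 \<bullet> z)"
      by (simp add: G_def label_def add_ac)
  qed
  have map: "(\<lambda>z. (e1 \<bullet> z, e2 \<bullet> z)) \<in> std_gaussian \<rightarrow>\<^sub>M borel \<Otimes>\<^sub>M borel"
    by (simp add: std_gaussian_def)
  have dom: "x \<in> loss_domain xs t h \<longleftrightarrow> integrable (?N \<Otimes>\<^sub>M ?N) G"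
    unfolding loss_domain_def mem_Collect_eq integrand distr_std_gaussian_orthonormal_pair[OF on', symmetric]
    by (rule integrable_distr_eq[OF map G, symmetric])
  have val: "loss xs t h x = integral\<^sup>L (?N \<Otimes>\<^sub>M ?N) G"
    unfolding loss_def integrand distr_std_gaussian_orthonormal_pair[OF on', symmetric]
    by (rule integral_distr[OF map G, symmetric])
  define F where "F = (\<lambda>g::real\<Rightarrow>real. \<lambda>u. g (- (r * u + t)) * Phi ((cos \<theta> * u + t) / sin \<theta>)
      + g (r * u + t) * Phi (- ((cos \<theta> * u + t) / sin \<theta>)))"
  have inner: "has_bochner_integral ?N (\<lambda>w. G (u, w)) (F h u)" for u
    using has_bochner_integral_sgn_cut[OF s, of h "cos \<theta> * u + t" "r * u + t"] by (simp add: G_def F_def)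
  have inner_abs: "has_bochner_integral ?N (\<lambda>w. \<bar>G (u, w)\<bar>) (F (\<lambda>v. \<bar>h v\<bar>) u)" for u
    using has_bochner_integral_sgn_cut[OF s, of "\<lambda>v. \<bar>h v\<bar>" "cos \<theta> * u + t" "r * u + t"] by (simp add: G_def F_def)
  have inner_eq: "(\<integral>w. G (u, w) \<partial>?N) = F h u"
    and inner_abs_eq: "(\<integral>w. \<bar>G (u, w)\<bar> \<partial>?N) = F (\<lambda>v. \<bar>h v\<bar>) u" for u
    using inner inner_abs by (blast intro: has_bochner_integral_integral_eq)+
  have F_eq: "loss_kernel g t r \<theta> v = \<bar>1 / r\<bar> * (std_normal_density (- t / r + 1 / r * v) * F g (- t / r + 1 / r * v))" for g v
  proof -
    have "- t / r + 1 / r * v = (v - t) / r" using r by (simp add: field_simps)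
    moreover have "r * ((v - t) / r) + t = v" using r by simp
    ultimately show ?thesis
      using r by (simp add: loss_kernel_def F_def thr_def add.commute)
  qed
  have Fm: "F g \<in> borel_measurable borel" if [measurable]: "g \<in> borel_measurable borel" for g
    unfolding F_def by measurable
  have int_F: "integrable ?N (F g) \<longleftrightarrow> integrable lborel (loss_kernel g t r \<theta>)"
    if g: "g \<in> borel_measurable borel" for g
  proof -
    note Fm[OF g, measurable]
    have "integrable ?N (F g) \<longleftrightarrow> integrable lborel (\<lambda>u. std_normal_density u * F g u)"
      by (subst integrable_density) auto
    also have "\<dots> \<longleftrightarrow> integrable lborel (\<lambda>v. std_normal_density (- t / r + 1 / r * v) * F g (- t / r + 1 / r * v))"
      using r by (intro lborel_integrable_real_affine_iff[symmetric]) auto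
    also have "\<dots> \<longleftrightarrow> integrable lborel (loss_kernel g t r \<theta>)"
      unfolding F_eq using r by (simp only: integrable_mult_left_iff) simp
    finally show ?thesis .
  qed
  show *: "x \<in> loss_domain xs t h \<longleftrightarrow> integrable lborel (loss_kernel (\<lambda>v. \<bar>h v\<bar>) t r \<theta>)"
  proof
    assume "x \<in> loss_domain xs t h"
    then have "integrable (?N \<Otimes>\<^sub>M ?N) (\<lambda>p. \<bar>G p\<bar>)"
      unfolding dom by (rule integrable_abs)
    then have "integrable ?N (\<lambda>u. \<integral>w. \<bar>G (u, w)\<bar> \<partial>?N)"
      by (rule NN.integrable_fst')
    then show "integrable lborel (loss_kernel (\<lambda>v. \<bar>h v\<bar>) t r \<theta>)"
      using int_F[of "\<lambda>v. \<bar>h v\<bar>"] by (simp add: inner_abs_eq)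
  next
    assume "integrable lborel (loss_kernel (\<lambda>v. \<bar>h v\<bar>) t r \<theta>)"
    then have "integrable ?N (\<lambda>u. \<integral>w. norm (G (u, w)) \<partial>?N)"
      using int_F[of "\<lambda>v. \<bar>h v\<bar>"] by (simp add: inner_abs_eq)
    moreover have "AE u in ?N. integrable ?N (\<lambda>w. G (u, w))"
      using inner by (auto simp: has_bochner_integral_iff)
    ultimately show "x \<in> loss_domain xs t h"
      unfolding dom using NN.Fubini_integrable[OF G'] by blast
  qed
  show "loss xs t h x = (\<integral>v. loss_kernel h t r \<theta> v \<partial>lborel)" if "x \<in> loss_domain xs t h"
  proof -
    note Fm[OF h, measurable]
    have "loss xs t h x = (\<integral>u. (\<integral>w. G (u, w) \<partial>?N) \<partial>?N)"
      unfolding val using that NN.integral_fst'[of G] by (simp add: dom)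
    also have "\<dots> = (\<integral>u. F h u \<partial>?N)"
      by (simp add: inner_eq)
    also have "\<dots> = (\<integral>u. std_normal_density u * F h u \<partial>lborel)"
      by (subst integral_density) auto
    also have "\<dots> = \<bar>1 / r\<bar> *\<^sub>R (\<integral>v. std_normal_density (- t / r + 1 / r * v) * F h (- t / r + 1 / r * v) \<partial>lborel)"
      using r by (intro lborel_integral_real_affine) auto
    also have "\<dots> = (\<integral>v. loss_kernel h t r \<theta> v \<partial>lborel)"
      unfolding F_eq by simp
    finally show ?thesis .
  qed
qed

section \<open>A majorant of the kernel and its derivatives\<close>

text \<open>The value of \<open>\<bar>h\<bar>\<close> at the point of \<open>{v, -v}\<close> that occurs when the label agrees with the sign of \<open>v - t\<close>. For
acute angles this event carries the full Gaussian tail of \<open>v\<close>.\<close>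

definition far_side :: "(real \<Rightarrow> real) \<Rightarrow> real \<Rightarrow> real \<Rightarrow> real" where
  "far_side h t v = (if t \<le> v then \<bar>h (- v)\<bar> else \<bar>h v\<bar>)"

text \<open>The first summand controls the event that the label agrees with the sign of \<open>v - t\<close>, for all norms
\<open>r \<le> \<rho>\<close>. The second one controls the opposite event: there the exponent \<open>- (v - t)\<^sup>2 / 2\<close> of the unit
sphere is available even for \<open>r\<close> slightly larger than 1. The constant \<open>A\<close> absorbs the shift \<open>t\<close>.\<close>

definition majorant :: "(real \<Rightarrow> real) \<Rightarrow> real \<Rightarrow> real \<Rightarrow> real \<Rightarrow> real \<Rightarrow> real" where
  "majorant h t A \<rho> v = (1 + (v - t)\<^sup>2) *
     (far_side h t v * exp (- (v - t)\<^sup>2 / (2 * \<rho>\<^sup>2)) +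
      (\<bar>h v\<bar> + \<bar>h (- v)\<bar>) * exp (- (v - t)\<^sup>2 / 2 + A * \<bar>v - t\<bar>))"

text \<open>The partial derivatives of \<open>loss_kernel\<close> with respect to \<open>\<theta>\<close> and to \<open>r\<close>.\<close>

definition loss_kernel_angle_deriv :: "(real \<Rightarrow> real) \<Rightarrow> real \<Rightarrow> real \<Rightarrow> real \<Rightarrow> real \<Rightarrow> real" where
  "loss_kernel_angle_deriv h t r \<theta> v =
     (h v - h (- v)) * (std_normal_density ((v - t) / r) / r) * std_normal_density (thr t r \<theta> v) *
     (((v - t) / r + t * cos \<theta>) / (sin \<theta>)\<^sup>2)"

definition loss_kernel_radial_deriv :: "(real \<Rightarrow> real) \<Rightarrow> real \<Rightarrow> real \<Rightarrow> real \<Rightarrow> real \<Rightarrow> real" where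
  "loss_kernel_radial_deriv h t r \<theta> v = (let U = (v - t) / r; q = thr t r \<theta> v in
     ((U\<^sup>2 - 1) * (std_normal_density U * (h (- v) * Phi q + h v * Phi (- q)))
      - cot \<theta> * U * (std_normal_density U * std_normal_density q * (h (- v) - h v))) / r\<^sup>2)"

lemma std_normal_density_minus: "std_normal_density (- x) = std_normal_density x"
  by (simp add: normal_density_def)

lemma std_normal_density_le_exp: "std_normal_density x \<le> exp (- x\<^sup>2 / 2)"
proof -
  have "1 \<le> sqrt (2 * pi)"
    using pi_gt3 by (simp add: real_le_rsqrt)
  then have "1 / sqrt (2 * pi) \<le> 1" by simp
  then show ?thesis
    unfolding std_normal_density_def by (intro mult_left_le_one_le) auto
qed

lemma DERIV_std_normal_density:
  "(std_normal_density has_real_derivative - x * std_normal_density x) (at x)"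
  unfolding normal_density_def by (auto intro!: derivative_eq_intros simp: field_simps)

lemma DERIV_loss_kernel_angle:
  assumes "sin \<theta> \<noteq> 0"
  shows "((\<lambda>\<theta>. loss_kernel h t r \<theta> v) has_real_derivative loss_kernel_angle_deriv h t r \<theta> v) (at \<theta>)"
proof -
  let ?U = "(v - t) / r"
  let ?d = "- (?U + t * cos \<theta>) / (sin \<theta>)\<^sup>2"
  have "((\<lambda>\<theta>. (t + cos \<theta> * u) / sin \<theta>) has_real_derivative
      ((- sin \<theta> * u) * sin \<theta> - (t + cos \<theta> * u) * cos \<theta>) / (sin \<theta> * sin \<theta>)) (at \<theta>)" for u
    using assms by (auto intro!: derivative_eq_intros)
  moreover have "(- sin \<theta> * u) * sin \<theta> - (t + cos \<theta> * u) * cos \<theta> = - (u + t * cos \<theta>)" for u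
  proof -
    have "(- sin \<theta> * u) * sin \<theta> - (t + cos \<theta> * u) * cos \<theta> = - (((sin \<theta>)\<^sup>2 + (cos \<theta>)\<^sup>2) * u + t * cos \<theta>)"
      unfolding power2_eq_square by (simp only: ring_distribs) (simp add: ac_simps)
    then show ?thesis by simp
  qed
  ultimately have "((\<lambda>\<theta>. (t + cos \<theta> * u) / sin \<theta>) has_real_derivative
      - (u + t * cos \<theta>) / (sin \<theta>)\<^sup>2) (at \<theta>)" for u
    unfolding power2_eq_square by (metis (no_types))
  then have q: "((\<lambda>\<theta>. thr t r \<theta> v) has_real_derivative ?d) (at \<theta>)"
    unfolding thr_def .
  have "((\<lambda>\<theta>. loss_kernel h t r \<theta> v) has_real_derivative
     std_normal_density ?U / r * (h (- v) * (std_normal_density (thr t r \<theta> v) * ?d) +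
        h v * (std_normal_density (- thr t r \<theta> v) * (- ?d)))) (at \<theta>)"
    unfolding loss_kernel_def
    by (intro DERIV_cmult DERIV_add DERIV_Phi DERIV_minus q)
  moreover have "D * (p * (Q * (- u / s)) + n * (Q * (- (- u / s)))) = (n - p) * D * Q * (u / s)"
    for D p Q u n s :: real
    by (simp add: algebra_simps diff_divide_distrib)
  ultimately show ?thesis
    unfolding std_normal_density_minus by (simp only: loss_kernel_angle_deriv_def)
qed

lemma DERIV_loss_kernel_radial:
  assumes r: "0 < r"
  shows "((\<lambda>r. loss_kernel h t r \<theta> v) has_real_derivative loss_kernel_radial_deriv h t r \<theta> v) (at r)"
proof -
  let ?U = "(v - t) / r" and ?q = "thr t r \<theta> v"
  have U: "((\<lambda>r. (v - t) / r) has_real_derivative - ?U / r) (at r)"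
    using r by (auto intro!: derivative_eq_intros simp: power2_eq_square field_simps)
  have q: "((\<lambda>r. thr t r \<theta> v) has_real_derivative (cos \<theta> * (- ?U / r)) / sin \<theta>) (at r)"
    unfolding thr_def by (rule DERIV_cdivide, rule DERIV_cong[OF DERIV_add[OF DERIV_const DERIV_cmult[OF U]]]) simp
  have d: "((\<lambda>r. std_normal_density ((v - t) / r) / r) has_real_derivative
      ((- ?U * std_normal_density ?U * (- ?U / r)) * r - std_normal_density ?U * 1) / (r * r)) (at r)"
    using r by (intro DERIV_divide DERIV_ident DERIV_chain2[OF DERIV_std_normal_density U]) auto
  have "((\<lambda>r. loss_kernel h t r \<theta> v) has_real_derivative
     (((- ?U * std_normal_density ?U * (- ?U / r)) * r - std_normal_density ?U * 1) / (r * r)) *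
        (h (- v) * Phi ?q + h v * Phi (- ?q)) +
     (h (- v) * (std_normal_density ?q * ((cos \<theta> * (- ?U / r)) / sin \<theta>)) +
      h v * (std_normal_density (- ?q) * (- ((cos \<theta> * (- ?U / r)) / sin \<theta>)))) *
        (std_normal_density ?U / r)) (at r)"
    unfolding loss_kernel_def
    by (intro DERIV_mult d DERIV_cmult DERIV_add DERIV_Phi DERIV_minus q)
  moreover have "(((- U * P * (- U / r)) * r - P * 1) / (r * r)) * X +
     (a * (Q * ((cos \<theta> * (- U / r)) / sin \<theta>)) + b * (Q * (- ((cos \<theta> * (- U / r)) / sin \<theta>)))) * (P / r)
     = ((U\<^sup>2 - 1) * (P * X) - cot \<theta> * U * (P * Q * (a - b))) / r\<^sup>2" for U P X a b Q
  proof -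
    have "(((- U * P * (- U / r)) * r - P * 1) / (r * r)) * X = ((U\<^sup>2 - 1) * (P * X)) / r\<^sup>2"
      using r by (simp add: power2_eq_square field_simps)
    moreover have "(a * (Q * ((cos \<theta> * (- U / r)) / sin \<theta>)) + b * (Q * (- ((cos \<theta> * (- U / r)) / sin \<theta>)))) * (P / r)
       = - (cot \<theta> * U * (P * Q * (a - b))) / r\<^sup>2"
      by (simp add: cot_def power2_eq_square algebra_simps diff_divide_distrib add_divide_distrib)
    ultimately show ?thesis
      by (simp add: diff_divide_distrib)
  qed
  ultimately show ?thesis
    unfolding std_normal_density_minus by (simp only: loss_kernel_radial_deriv_def Let_def)
qed

lemma majorant_nonneg: "0 \<le> majorant h t A \<rho> v"
  by (auto simp: majorant_def far_side_def intro!: mult_nonneg_nonneg add_nonneg_nonneg)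

text \<open>For \<open>U \<ge> 0\<close> the threshold \<open>q\<close> grows at least like \<open>U cot b\<close>, so a negative label has a probability with
Gaussian decay in \<open>U\<close>; symmetrically for \<open>U \<le> 0\<close>. The Chernoff bound with parameter \<open>k \<bar>U\<bar>\<close> spares a case
distinction on the sign of \<open>q\<close>.\<close>

lemma thr_tail:
  fixes t U :: real
  assumes th: "0 < a" "a \<le> \<theta>" "\<theta> \<le> b" "b < pi / 2"
    and k: "k = cot b" and q: "q = (t + cos \<theta> * U) / sin \<theta>"
  defines "E \<equiv> exp (- k\<^sup>2 * U\<^sup>2 / 2 + k * \<bar>t\<bar> / sin a * \<bar>U\<bar>)"
  shows "0 \<le> U \<Longrightarrow> Phi (- q) \<le> E" "U \<le> 0 \<Longrightarrow> Phi q \<le> E" "std_normal_density q \<le> E"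
proof -
  have sina: "0 < sin a" "sin a \<le> sin \<theta>" "sin \<theta> \<le> sin b"
    using th by (auto intro!: sin_gt_zero sin_monotone_2pi_le)
  have cosb: "0 < cos b" "cos b \<le> cos \<theta>"
    using th by (auto intro!: cos_gt_zero_pi cos_monotone_0_pi_le)
  have k0: "0 < k"
    using sina cosb by (simp add: k cot_def)
  have cot: "k \<le> cos \<theta> / sin \<theta>"
    unfolding k cot_def using sina cosb by (intro frac_le) auto
  have tq: "- (\<bar>t\<bar> / sin a) \<le> t / sin \<theta>" "t / sin \<theta> \<le> \<bar>t\<bar> / sin a"
  proof -
    have "\<bar>t / sin \<theta>\<bar> \<le> \<bar>t\<bar> / sin a"
      using sina by (auto simp: abs_divide intro!: frac_le)
    then show "- (\<bar>t\<bar> / sin a) \<le> t / sin \<theta>" "t / sin \<theta> \<le> \<bar>t\<bar> / sin a" by linarith+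
  qed
  have q': "q = t / sin \<theta> + cos \<theta> / sin \<theta> * U"
    by (simp add: q add_divide_distrib)
  define l where "l = k * \<bar>U\<bar>"
  have l: "0 \<le> l" using k0 by (simp add: l_def)
  have pos: "l\<^sup>2 / 2 - l * q \<le> - k\<^sup>2 * U\<^sup>2 / 2 + k * \<bar>t\<bar> / sin a * \<bar>U\<bar>" if "0 \<le> U"
  proof -
    have "k * U - \<bar>t\<bar> / sin a \<le> q"
      unfolding q' using tq mult_right_mono[OF cot that] by linarith
    then have "l * (k * U - \<bar>t\<bar> / sin a) \<le> l * q"
      using l by (rule mult_left_mono)
    moreover have "l * (k * U - \<bar>t\<bar> / sin a) = k\<^sup>2 * U\<^sup>2 - k * \<bar>t\<bar> / sin a * \<bar>U\<bar>"
      using that by (simp add: l_def power2_eq_square algebra_simps)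
    moreover have "l\<^sup>2 = k\<^sup>2 * U\<^sup>2"
      by (simp add: l_def power_mult_distrib)
    ultimately show ?thesis by simp
  qed
  have neg: "l\<^sup>2 / 2 + l * q \<le> - k\<^sup>2 * U\<^sup>2 / 2 + k * \<bar>t\<bar> / sin a * \<bar>U\<bar>" if "U \<le> 0"
  proof -
    have "q \<le> k * U + \<bar>t\<bar> / sin a"
      unfolding q' using tq mult_right_mono_neg[OF cot that] by linarith
    then have "l * q \<le> l * (k * U + \<bar>t\<bar> / sin a)"
      using l by (rule mult_left_mono)
    moreover have "l * (k * U + \<bar>t\<bar> / sin a) = - (k\<^sup>2 * U\<^sup>2) + k * \<bar>t\<bar> / sin a * \<bar>U\<bar>"
      using that by (simp add: l_def power2_eq_square algebra_simps)
    moreover have "l\<^sup>2 = k\<^sup>2 * U\<^sup>2"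
      by (simp add: l_def power_mult_distrib)
    ultimately show ?thesis by simp
  qed
  show "Phi (- q) \<le> E" if "0 \<le> U"
    using Phi_le_exp[OF l, of "- q"] pos[OF that] unfolding E_def
    by (auto intro: order_trans)
  show "Phi q \<le> E" if "U \<le> 0"
    using Phi_le_exp[OF l, of q] neg[OF that] unfolding E_def
    by (auto intro: order_trans)
  have sq: "- q\<^sup>2 / 2 \<le> l\<^sup>2 / 2 - l * q" "- q\<^sup>2 / 2 \<le> l\<^sup>2 / 2 + l * q"
    using zero_le_power2[of "q - l"] zero_le_power2[of "q + l"]
    by (auto simp: power2_eq_square algebra_simps)
  have "- q\<^sup>2 / 2 \<le> - k\<^sup>2 * U\<^sup>2 / 2 + k * \<bar>t\<bar> / sin a * \<bar>U\<bar>"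
  proof (cases "0 \<le> U")
    case True
    show ?thesis by (rule order_trans[OF sq(1) pos[OF True]])
  next
    case False
    then have "U \<le> 0" by simp
    then show ?thesis by (rule order_trans[OF sq(2) neg])
  qed
  then show "std_normal_density q \<le> E"
    unfolding E_def by (intro order_trans[OF std_normal_density_le_exp]) simp
qed

text \<open>On the rectangle \<open>r \<in> {1/2..\<rho>}\<close>, \<open>\<theta> \<in> {a..b}\<close> the kernel and its partial derivatives are dominated by one
function of \<open>v\<close>. The condition \<open>\<rho>\<^sup>2 \<le> 1 + (cot b)\<^sup>2\<close> says that the additional decay \<open>exp (- (cot b)\<^sup>2 U\<^sup>2 / 2)\<close>
from \<open>thr_tail\<close> makes up for a norm larger than 1.\<close>

lemma loss_kernel_majorised:
  fixes t :: real
  assumes ab: "0 < a" "a \<le> b" "b < pi / 2"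
  defines "A \<equiv> 2 * (cot b * \<bar>t\<bar> / sin a)"
  shows "\<exists>C\<ge>0. \<forall>h \<rho> r \<theta> v. 1 \<le> \<rho> \<longrightarrow> \<rho>\<^sup>2 \<le> 1 + (cot b)\<^sup>2 \<longrightarrow> 1 / 2 \<le> r \<longrightarrow> r \<le> \<rho> \<longrightarrow> a \<le> \<theta> \<longrightarrow> \<theta> \<le> b \<longrightarrow>
     \<bar>loss_kernel h t r \<theta> v\<bar> \<le> C * majorant h t A \<rho> v \<and>
     \<bar>loss_kernel_radial_deriv h t r \<theta> v\<bar> \<le> C * majorant h t A \<rho> v \<and>
     \<bar>loss_kernel_angle_deriv h t r \<theta> v\<bar> \<le> C * majorant h t A \<rho> v"
proof -
  \<comment> \<open>The three summands serve the kernel, its angular derivative and its radial derivative.\<close>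
  define C where "C = 2 + 2 * (1 + \<bar>t\<bar>) / (sin a)\<^sup>2 + (16 + 4 / sin a)"
  have sina: "0 < sin a"
    using ab by (auto intro!: sin_gt_zero)
  have C3: "0 \<le> C" "2 \<le> C" "2 * (1 + \<bar>t\<bar>) / (sin a)\<^sup>2 \<le> C" "16 + 4 / sin a \<le> C"
    using sina by (auto simp: C_def)
  have "\<bar>loss_kernel h t r \<theta> v\<bar> \<le> C * majorant h t A \<rho> v \<and>
     \<bar>loss_kernel_radial_deriv h t r \<theta> v\<bar> \<le> C * majorant h t A \<rho> v \<and>
     \<bar>loss_kernel_angle_deriv h t r \<theta> v\<bar> \<le> C * majorant h t A \<rho> v"
    if rho: "1 \<le> \<rho>" "\<rho>\<^sup>2 \<le> 1 + (cot b)\<^sup>2" and r: "1 / 2 \<le> r" "r \<le> \<rho>" and th: "a \<le> \<theta>" "\<theta> \<le> b"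
    for h \<rho> r \<theta> v
  proof -
    define U where "U = (v - t) / r"
    define q where "q = thr t r \<theta> v"
    define k where "k = cot b"
    define B where "B = k * \<bar>t\<bar> / sin a"
    define P where "P = std_normal_density U"
    define Q where "Q = std_normal_density q"
    define p where "p = \<bar>h (- v)\<bar>"
    define n where "n = \<bar>h v\<bar>"
    define X where "X = exp (- (v - t)\<^sup>2 / (2 * \<rho>\<^sup>2))"
    define Y where "Y = exp (- (v - t)\<^sup>2 / 2 + A * \<bar>v - t\<bar>)"
    define E where "E = exp (- k\<^sup>2 * U\<^sup>2 / 2 + B * \<bar>U\<bar>)"
    define W where "W = far_side h t v * X + (n + p) * Y"
    define x where "x = \<bar>v - t\<bar>"
    have sin: "sin a \<le> sin \<theta>" "0 < sin \<theta>" "sin \<theta> \<le> 1"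
      using ab th sina by (auto intro!: sin_monotone_2pi_le intro: less_le_trans)
    have cos: "0 \<le> cos \<theta>" "cos \<theta> \<le> 1"
      using ab th by (auto intro!: cos_ge_zero)
    have k0: "0 \<le> k"
      using ab by (auto simp: k_def cot_def intro!: divide_nonneg_nonneg cos_ge_zero sin_ge_zero)
    have B0: "0 \<le> B" and AB: "A = 2 * B"
      using k0 sina by (auto simp: B_def A_def k_def)
    have r0: "0 < r" using r by simp
    have nn: "0 \<le> P" "0 \<le> Q" "0 \<le> p" "0 \<le> n" "0 \<le> X" "0 \<le> Y" "0 \<le> E" "0 \<le> x"
      by (auto simp: P_def Q_def p_def n_def X_def Y_def E_def x_def)
    have Uabs: "\<bar>U\<bar> \<le> 2 * x"
    proof -
      have "\<bar>U\<bar> = x / r" using r0 by (simp add: U_def x_def abs_divide)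
      also have "\<dots> \<le> x / (1 / 2)" using r nn by (intro divide_left_mono) auto
      finally show ?thesis by simp
    qed
    have U2: "U\<^sup>2 \<le> 4 * x\<^sup>2"
      using power_mono[OF Uabs, of 2] by (simp add: power_mult_distrib)
    have Usq: "U\<^sup>2 = (v - t)\<^sup>2 / r\<^sup>2"
      by (simp add: U_def power_divide)
    have PX: "P \<le> X"
    proof -
      have "(v - t)\<^sup>2 / \<rho>\<^sup>2 \<le> U\<^sup>2"
        unfolding Usq using r r0 by (intro divide_left_mono power_mono mult_pos_pos) auto
      then have "- U\<^sup>2 / 2 \<le> - (v - t)\<^sup>2 / (2 * \<rho>\<^sup>2)"
        by simp
      then show ?thesis
        unfolding P_def X_def by (intro order_trans[OF std_normal_density_le_exp]) simp
    qed
    have PE: "P * E \<le> Y"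
    proof -
      have "(v - t)\<^sup>2 = U\<^sup>2 * r\<^sup>2"
        using r0 by (simp add: Usq)
      also have "\<dots> \<le> U\<^sup>2 * (1 + k\<^sup>2)"
        using order_trans[OF power_mono[OF r(2), of 2] rho(2)] r0 by (intro mult_left_mono) (auto simp: k_def)
      finally have "(v - t)\<^sup>2 \<le> U\<^sup>2 + k\<^sup>2 * U\<^sup>2" by (simp add: algebra_simps)
      moreover have "B * \<bar>U\<bar> \<le> A * \<bar>v - t\<bar>"
        using mult_left_mono[OF Uabs B0] by (simp add: AB x_def)
      ultimately have "- U\<^sup>2 / 2 + (- k\<^sup>2 * U\<^sup>2 / 2 + B * \<bar>U\<bar>) \<le> - (v - t)\<^sup>2 / 2 + A * \<bar>v - t\<bar>"
        by simp
      then have "exp (- U\<^sup>2 / 2) * E \<le> Y"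
        by (simp add: E_def Y_def flip: exp_add)
      moreover have "P * E \<le> exp (- U\<^sup>2 / 2) * E"
        unfolding P_def using nn(7) by (intro mult_right_mono std_normal_density_le_exp)
      ultimately show ?thesis by linarith
    qed
    note tail = thr_tail[OF ab(1) th ab(3) refl, of q t U, folded k_def, folded B_def, folded E_def]
    have q_eq: "q = (t + cos \<theta> * U) / sin \<theta>"
      by (simp add: q_def thr_def U_def)
    have QE: "P * Q \<le> Y"
      using tail(3)[OF q_eq] PE mult_left_mono[of Q E P] nn by (simp add: Q_def)
    have PPhi: "P * Phi c \<le> X" for c
      using PX nn mult_left_mono[of "Phi c" 1 P] by simp
    have W0: "0 \<le> W"
      using nn by (auto simp: W_def far_side_def)
    have PW: "P * (p * Phi q + n * Phi (- q)) \<le> W"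
    proof (cases "t \<le> v")
      case True
      then have "0 \<le> U" using r0 by (simp add: U_def)
      then have "P * Phi (- q) \<le> Y"
        using tail(1)[OF q_eq] PE mult_left_mono[of "Phi (- q)" E P] nn by simp
      then have "p * (P * Phi q) + n * (P * Phi (- q)) \<le> p * X + n * Y"
        using PPhi nn by (intro add_mono mult_left_mono)
      moreover have "0 \<le> p * Y" using nn by simp
      ultimately show ?thesis
        using True by (simp add: W_def far_side_def p_def[symmetric] algebra_simps)
    next
      case False
      then have "U \<le> 0" using r0 by (simp add: U_def divide_nonpos_pos)
      then have "P * Phi q \<le> Y"
        using tail(2)[OF q_eq] PE mult_left_mono[of "Phi q" E P] nn by simp
      then have "p * (P * Phi q) + n * (P * Phi (- q)) \<le> p * Y + n * X"
        using PPhi nn by (intro add_mono mult_left_mono)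
      moreover have "0 \<le> n * Y" using nn by simp
      ultimately show ?thesis
        using False by (simp add: W_def far_side_def n_def[symmetric] algebra_simps)
    qed
    have PQW: "P * Q * (p + n) \<le> W"
    proof -
      have "P * Q * (p + n) \<le> Y * (p + n)"
        using QE nn by (intro mult_right_mono) auto
      moreover have "0 \<le> far_side h t v * X"
        using nn by (auto simp: far_side_def)
      ultimately show ?thesis
        by (simp add: W_def algebra_simps)
    qed
    have M: "majorant h t A \<rho> v = (1 + x\<^sup>2) * W"
      by (simp add: majorant_def W_def X_def Y_def x_def n_def p_def)
    have WM: "W \<le> majorant h t A \<rho> v"
      unfolding M using W0 mult_right_mono[of 1 "1 + x\<^sup>2" W] by simp
    have M0: "0 \<le> majorant h t A \<rho> v"
      by (rule majorant_nonneg)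
    have CM: "c * majorant h t A \<rho> v \<le> C * majorant h t A \<rho> v" if "c \<le> C" for c
      using that M0 by (rule mult_right_mono)
    have habs: "\<bar>P * (h (- v) * Phi q + h v * Phi (- q))\<bar> \<le> W"
    proof -
      have "\<bar>h (- v) * Phi q + h v * Phi (- q)\<bar> \<le> p * Phi q + n * Phi (- q)"
        unfolding p_def n_def by (intro order_trans[OF abs_triangle_ineq]) (simp add: abs_mult)
      then have "P * \<bar>h (- v) * Phi q + h v * Phi (- q)\<bar> \<le> P * (p * Phi q + n * Phi (- q))"
        using nn by (intro mult_left_mono)
      then show ?thesis
        using PW nn by (simp add: abs_mult)
    qed
    have hdiff: "\<bar>P * Q * (h (- v) - h v)\<bar> \<le> W"
    proof -
      have "\<bar>h (- v) - h v\<bar> \<le> p + n"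
        unfolding p_def n_def by (rule abs_triangle_ineq4)
      then have "P * Q * \<bar>h (- v) - h v\<bar> \<le> P * Q * (p + n)"
        using nn by (intro mult_left_mono) auto
      then show ?thesis
        using PQW nn by (simp add: abs_mult)
    qed
    have x1: "2 * x \<le> 1 + x\<^sup>2"
      using zero_le_power2[of "x - 1"] by (simp add: power2_eq_square algebra_simps)
    have K: "\<bar>loss_kernel h t r \<theta> v\<bar> \<le> C * majorant h t A \<rho> v"
    proof -
      have "\<bar>loss_kernel h t r \<theta> v\<bar> = \<bar>P * (h (- v) * Phi q + h v * Phi (- q))\<bar> / r"
        using r0 by (simp add: loss_kernel_def P_def q_def U_def abs_mult abs_divide)
      also have "\<dots> \<le> W / (1 / 2)"
        using habs r W0 by (intro frac_le) auto
      also have "\<dots> \<le> 2 * majorant h t A \<rho> v"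
        using WM by simp
      finally show ?thesis
        using CM[OF C3(2)] by linarith
    qed
    have R: "\<bar>loss_kernel_radial_deriv h t r \<theta> v\<bar> \<le> C * majorant h t A \<rho> v"
    proof -
      have c: "\<bar>cot \<theta>\<bar> \<le> 1 / sin a"
        using cos sin sina by (auto simp: cot_def abs_divide intro!: frac_le)
      have "\<bar>(U\<^sup>2 - 1) * (P * (h (- v) * Phi q + h v * Phi (- q)))\<bar> \<le> (4 * x\<^sup>2 + 1) * W"
        unfolding abs_mult[of "U\<^sup>2 - 1"]
      proof (intro mult_mono habs)
        show "\<bar>U\<^sup>2 - 1\<bar> \<le> 4 * x\<^sup>2 + 1"
          unfolding abs_le_iff using U2 zero_le_power2[of U] zero_le_power2[of x] by linarith
      qed auto
      moreover have "\<bar>cot \<theta> * U * (P * Q * (h (- v) - h v))\<bar> \<le> (1 / sin a * (2 * x)) * W"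
        unfolding abs_mult[of "cot \<theta> * U"] abs_mult[of "cot \<theta>"] using c Uabs hdiff sina nn
        by (intro mult_mono mult_nonneg_nonneg) auto
      ultimately have "\<bar>(U\<^sup>2 - 1) * (P * (h (- v) * Phi q + h v * Phi (- q))) - cot \<theta> * U * (P * Q * (h (- v) - h v))\<bar>
          \<le> (4 * x\<^sup>2 + 1) * W + (1 / sin a * (2 * x)) * W"
        by (intro order_trans[OF abs_triangle_ineq4 add_mono])
      also have "\<dots> \<le> (4 * (1 + x\<^sup>2)) * W + (1 / sin a * (1 + x\<^sup>2)) * W"
        using x1 sina W0 by (intro add_mono mult_right_mono mult_left_mono) auto
      also have "\<dots> = (4 + 1 / sin a) * majorant h t A \<rho> v"
        by (simp add: M algebra_simps)
      finally have num: "\<bar>(U\<^sup>2 - 1) * (P * (h (- v) * Phi q + h v * Phi (- q))) - cot \<theta> * U * (P * Q * (h (- v) - h v))\<bar>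
          \<le> (4 + 1 / sin a) * majorant h t A \<rho> v" .
      have r2: "1 / 4 \<le> r\<^sup>2"
        using power_mono[OF r(1), of 2] by (simp add: power_divide)
      have "\<bar>loss_kernel_radial_deriv h t r \<theta> v\<bar>
          = \<bar>(U\<^sup>2 - 1) * (P * (h (- v) * Phi q + h v * Phi (- q))) - cot \<theta> * U * (P * Q * (h (- v) - h v))\<bar> / r\<^sup>2"
        by (simp add: loss_kernel_radial_deriv_def Let_def U_def[symmetric] q_def[symmetric] P_def[symmetric] Q_def[symmetric] abs_divide)
      also have "\<dots> \<le> ((4 + 1 / sin a) * majorant h t A \<rho> v) / (1 / 4)"
        using num r2 M0 sina by (intro frac_le) auto
      also have "\<dots> = (16 + 4 / sin a) * majorant h t A \<rho> v"
        by (simp add: algebra_simps)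
      finally show ?thesis
        using CM[OF C3(4)] by linarith
    qed
    have T: "\<bar>loss_kernel_angle_deriv h t r \<theta> v\<bar> \<le> C * majorant h t A \<rho> v"
    proof -
      have "\<bar>U + t * cos \<theta>\<bar> \<le> \<bar>U\<bar> + \<bar>t\<bar>"
        using cos mult_left_mono[of "cos \<theta>" 1 "\<bar>t\<bar>"]
        by (intro order_trans[OF abs_triangle_ineq]) (auto simp: abs_mult)
      also have "\<dots> \<le> (1 + x\<^sup>2) * (1 + \<bar>t\<bar>)"
      proof -
        have "(1 + x\<^sup>2) * (1 + \<bar>t\<bar>) = 1 + x\<^sup>2 + \<bar>t\<bar> + x\<^sup>2 * \<bar>t\<bar>"
          by (simp add: algebra_simps)
        moreover have "0 \<le> x\<^sup>2 * \<bar>t\<bar>" by simp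
        ultimately show ?thesis
          using Uabs x1 by linarith
      qed
      finally have "\<bar>U + t * cos \<theta>\<bar> \<le> (1 + x\<^sup>2) * (1 + \<bar>t\<bar>)" .
      then have Ut: "\<bar>(U + t * cos \<theta>) / (sin \<theta>)\<^sup>2\<bar> \<le> ((1 + x\<^sup>2) * (1 + \<bar>t\<bar>)) / (sin a)\<^sup>2"
        unfolding abs_divide using sin sina by (intro frac_le) (auto intro!: power_mono)
      have "\<bar>loss_kernel_angle_deriv h t r \<theta> v\<bar>
        = \<bar>P * Q * (h (- v) - h v)\<bar> / r * \<bar>(U + t * cos \<theta>) / (sin \<theta>)\<^sup>2\<bar>"
        using r0 by (simp add: loss_kernel_angle_deriv_def U_def[symmetric] q_def[symmetric] P_def[symmetric] Q_def[symmetric]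
            abs_mult abs_divide abs_minus_commute)
      also have "\<dots> \<le> W / (1 / 2) * (((1 + x\<^sup>2) * (1 + \<bar>t\<bar>)) / (sin a)\<^sup>2)"
        using hdiff r W0 Ut by (intro mult_mono frac_le) auto
      also have "\<dots> = (2 * (1 + \<bar>t\<bar>) / (sin a)\<^sup>2) * majorant h t A \<rho> v"
        by (simp add: M)
      finally show ?thesis
        using CM[OF C3(3)] by linarith
    qed
    show ?thesis
      using K R T by blast
  qed
  then show ?thesis
    using C3(1) by blast
qed

section \<open>Integrability of the majorant\<close>

text \<open>Integrability of \<open>h\<close> against all Gaussians of variance 1 gives integrability against \<open>exp (- v\<^sup>2 / 2)\<close> with
arbitrary exponential weights, hence also with polynomial ones.\<close>

lemma integrable_exp_abs_of_gaussian_shifts: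
  fixes h :: "real \<Rightarrow> real"
  assumes h[measurable]: "h \<in> borel_measurable borel"
    and int: "\<And>a. integrable std_normal_distribution (\<lambda>s. \<bar>h (a + s)\<bar>)"
  shows "integrable lborel (\<lambda>v. \<bar>h v\<bar> * exp (- v\<^sup>2 / 2 + A * \<bar>v\<bar>))"
proof -
  have shift: "integrable lborel (\<lambda>v. std_normal_density (v - a) * \<bar>h v\<bar>)" for a
  proof -
    have "integrable lborel (\<lambda>s. std_normal_density s * \<bar>h (a + s)\<bar>)"
      using int[of a] by (subst (asm) integrable_density) auto
    from lborel_integrable_real_affine[OF this, of 1 "- a"] show ?thesis
      by simp
  qed
  \<comment> \<open>The Gaussian with mean \<open>a\<close> is \<open>exp (- v\<^sup>2 / 2 + a v)\<close> up to this factor; the means \<open>A\<close> and \<open>- A\<close> suffice.\<close>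
  define c where "c = sqrt (2 * pi) * exp (A\<^sup>2 / 2)"
  have "integrable lborel (\<lambda>v. c * (std_normal_density (v - A) * \<bar>h v\<bar> + std_normal_density (v - (- A)) * \<bar>h v\<bar>))"
    by (intro integrable_mult_right Bochner_Integration.integrable_add shift)
  then show ?thesis
  proof (rule Bochner_Integration.integrable_bound)
    show "AE v in lborel. norm (\<bar>h v\<bar> * exp (- v\<^sup>2 / 2 + A * \<bar>v\<bar>))
        \<le> norm (c * (std_normal_density (v - A) * \<bar>h v\<bar> + std_normal_density (v - (- A)) * \<bar>h v\<bar>))"
    proof (rule AE_I2)
      fix v
      have e: "c * std_normal_density (v - a) = exp (- v\<^sup>2 / 2 + a * v)" if "a\<^sup>2 = A\<^sup>2" for a
      proof -
        have "c * std_normal_density (v - a) = exp (A\<^sup>2 / 2) * exp (- (v - a)\<^sup>2 / 2)"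
          by (simp add: c_def std_normal_density_def)
        also have "\<dots> = exp (a\<^sup>2 / 2 + - (v - a)\<^sup>2 / 2)"
          by (simp only: that exp_add)
        also have "a\<^sup>2 / 2 + - (v - a)\<^sup>2 / 2 = - v\<^sup>2 / 2 + a * v"
          by (simp add: power2_eq_square field_simps)
        finally show ?thesis .
      qed
      have "exp (- v\<^sup>2 / 2 + A * \<bar>v\<bar>) \<le> exp (- v\<^sup>2 / 2 + A * v) + exp (- v\<^sup>2 / 2 + (- A) * v)"
        by (cases "0 \<le> v") auto
      also have "\<dots> = c * std_normal_density (v - A) + c * std_normal_density (v - (- A))"
        by (simp only: e[of A] e[of "- A"] power2_minus)
      finally have "\<bar>h v\<bar> * exp (- v\<^sup>2 / 2 + A * \<bar>v\<bar>)
          \<le> \<bar>h v\<bar> * (c * std_normal_density (v - A) + c * std_normal_density (v - (- A)))"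
        by (intro mult_left_mono) auto
      also have "\<dots> = c * (std_normal_density (v - A) * \<bar>h v\<bar> + std_normal_density (v - (- A)) * \<bar>h v\<bar>)"
        by (simp only: algebra_simps)
      finally show "norm (\<bar>h v\<bar> * exp (- v\<^sup>2 / 2 + A * \<bar>v\<bar>))
        \<le> norm (c * (std_normal_density (v - A) * \<bar>h v\<bar> + std_normal_density (v - (- A)) * \<bar>h v\<bar>))"
        by simp
    qed
  qed auto
qed

text \<open>Integrability of the first summand of \<open>majorant\<close>, the only one for which norms larger than 1 matter.\<close>

definition far_integrable :: "(real \<Rightarrow> real) \<Rightarrow> real \<Rightarrow> real \<Rightarrow> bool" where
  "far_integrable h t \<rho> \<longleftrightarrow>
     integrable lborel (\<lambda>v. (1 + (v - t)\<^sup>2) * (far_side h t v * exp (- (v - t)\<^sup>2 / (2 * \<rho>\<^sup>2))))"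

lemma borel_measurable_far_side [measurable]:
  fixes h :: "real \<Rightarrow> real"
  assumes [measurable]: "h \<in> borel_measurable borel"
  shows "far_side h t \<in> borel_measurable borel"
  unfolding far_side_def[abs_def] by measurable

lemma integrable_near_part:
  fixes h :: "real \<Rightarrow> real"
  assumes h[measurable]: "h \<in> borel_measurable borel"
    and int: "\<And>a. integrable std_normal_distribution (\<lambda>s. \<bar>h (a + s)\<bar>)"
    and A: "0 \<le> A"
  shows "integrable lborel (\<lambda>v. (1 + (v - t)\<^sup>2) * ((\<bar>h v\<bar> + \<bar>h (- v)\<bar>) * exp (- (v - t)\<^sup>2 / 2 + A * \<bar>v - t\<bar>)))"
proof -
  define A' where "A' = \<bar>t\<bar> + A + 1"
  define c where "c = 2 * exp ((A + 1) * \<bar>t\<bar>)"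
  let ?f = "\<lambda>v. \<bar>h v\<bar> * exp (- v\<^sup>2 / 2 + A' * \<bar>v\<bar>)"
  have f: "integrable lborel ?f"
    by (rule integrable_exp_abs_of_gaussian_shifts[OF h int])
  from lborel_integrable_real_affine[OF this, of "-1" 0]
  have "integrable lborel (\<lambda>v. \<bar>h (- v)\<bar> * exp (- v\<^sup>2 / 2 + A' * \<bar>v\<bar>))"
    by simp
  with f have "integrable lborel (\<lambda>v. c * (?f v + \<bar>h (- v)\<bar> * exp (- v\<^sup>2 / 2 + A' * \<bar>v\<bar>)))"
    by (intro integrable_mult_right Bochner_Integration.integrable_add)
  then show ?thesis
  proof (rule Bochner_Integration.integrable_bound)
    show "AE v in lborel. norm ((1 + (v - t)\<^sup>2) * ((\<bar>h v\<bar> + \<bar>h (- v)\<bar>) * exp (- (v - t)\<^sup>2 / 2 + A * \<bar>v - t\<bar>)))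
      \<le> norm (c * (?f v + \<bar>h (- v)\<bar> * exp (- v\<^sup>2 / 2 + A' * \<bar>v\<bar>)))"
    proof (rule AE_I2)
      fix v
      define x where "x = \<bar>v - t\<bar>"
      have x0: "0 \<le> x" by (simp add: x_def)
      have "1 + x\<^sup>2 \<le> 2 * (1 + x + x\<^sup>2 / 2)"
        using x0 by simp
      also have "\<dots> \<le> 2 * exp x"
        using exp_lower_Taylor_quadratic[OF x0] by simp
      finally have x2: "1 + x\<^sup>2 \<le> 2 * exp x" .
      have xv: "x \<le> \<bar>v\<bar> + \<bar>t\<bar>" by (simp add: x_def abs_triangle_ineq4)
      have tv: "t * v \<le> \<bar>t\<bar> * \<bar>v\<bar>"
        using abs_ge_self[of "t * v"] by (simp add: abs_mult)
      have "(1 + x\<^sup>2) * exp (- x\<^sup>2 / 2 + A * x) \<le> 2 * exp x * exp (- x\<^sup>2 / 2 + A * x)"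
        using x2 by (intro mult_right_mono) auto
      also have "\<dots> = 2 * exp (- x\<^sup>2 / 2 + (A + 1) * x)"
        by (simp add: algebra_simps flip: exp_add)
      also have "- x\<^sup>2 / 2 + (A + 1) * x \<le> (A + 1) * \<bar>t\<bar> + (- v\<^sup>2 / 2 + A' * \<bar>v\<bar>)"
      proof -
        have "- x\<^sup>2 / 2 \<le> - v\<^sup>2 / 2 + t * v"
          by (simp add: x_def power2_eq_square field_simps)
        moreover have "(A + 1) * x \<le> (A + 1) * (\<bar>v\<bar> + \<bar>t\<bar>)"
          using xv A by (intro mult_left_mono) auto
        moreover have "\<bar>t\<bar> * \<bar>v\<bar> + (A + 1) * (\<bar>v\<bar> + \<bar>t\<bar>) = (A + 1) * \<bar>t\<bar> + A' * \<bar>v\<bar>"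
          by (simp add: A'_def algebra_simps)
        ultimately show ?thesis
          using tv by linarith
      qed
      finally have "(1 + x\<^sup>2) * exp (- x\<^sup>2 / 2 + A * x) \<le> c * exp (- v\<^sup>2 / 2 + A' * \<bar>v\<bar>)"
        by (simp add: c_def exp_add mult.assoc)
      then have "(\<bar>h v\<bar> + \<bar>h (- v)\<bar>) * ((1 + x\<^sup>2) * exp (- x\<^sup>2 / 2 + A * x))
          \<le> (\<bar>h v\<bar> + \<bar>h (- v)\<bar>) * (c * exp (- v\<^sup>2 / 2 + A' * \<bar>v\<bar>))"
        by (intro mult_left_mono) auto
      moreover have "x\<^sup>2 = (v - t)\<^sup>2" by (simp add: x_def)
      ultimately have "(1 + (v - t)\<^sup>2) * ((\<bar>h v\<bar> + \<bar>h (- v)\<bar>) * exp (- (v - t)\<^sup>2 / 2 + A * \<bar>v - t\<bar>))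
          \<le> c * (?f v + \<bar>h (- v)\<bar> * exp (- v\<^sup>2 / 2 + A' * \<bar>v\<bar>))"
        by (simp add: algebra_simps x_def)
      moreover have "0 \<le> (1 + (v - t)\<^sup>2) * ((\<bar>h v\<bar> + \<bar>h (- v)\<bar>) * exp (- (v - t)\<^sup>2 / 2 + A * \<bar>v - t\<bar>))"
        by (intro mult_nonneg_nonneg add_nonneg_nonneg) auto
      ultimately show "norm ((1 + (v - t)\<^sup>2) * ((\<bar>h v\<bar> + \<bar>h (- v)\<bar>) * exp (- (v - t)\<^sup>2 / 2 + A * \<bar>v - t\<bar>)))
          \<le> norm (c * (?f v + \<bar>h (- v)\<bar> * exp (- v\<^sup>2 / 2 + A' * \<bar>v\<bar>)))"
        unfolding real_norm_def by linarith
    qed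
  qed auto
qed

lemma integrable_majorant:
  assumes "h \<in> borel_measurable borel"
    and "\<And>a. integrable std_normal_distribution (\<lambda>s. \<bar>h (a + s)\<bar>)"
    and "0 \<le> A" "far_integrable h t \<rho>"
  shows "integrable lborel (majorant h t A \<rho>)"
proof -
  have "majorant h t A \<rho> = (\<lambda>v. (1 + (v - t)\<^sup>2) * (far_side h t v * exp (- (v - t)\<^sup>2 / (2 * \<rho>\<^sup>2)))
     + (1 + (v - t)\<^sup>2) * ((\<bar>h v\<bar> + \<bar>h (- v)\<bar>) * exp (- (v - t)\<^sup>2 / 2 + A * \<bar>v - t\<bar>)))"
    by (simp add: majorant_def fun_eq_iff distrib_left)
  then show ?thesis
    using integrable_near_part[OF assms(1-3)] assms(4) by (simp add: far_integrable_def)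
qed

lemma far_integrable_1:
  fixes h :: "real \<Rightarrow> real"
  assumes h[measurable]: "h \<in> borel_measurable borel"
    and int: "\<And>a. integrable std_normal_distribution (\<lambda>s. \<bar>h (a + s)\<bar>)"
  shows "far_integrable h t 1"
  unfolding far_integrable_def
proof (rule Bochner_Integration.integrable_bound[OF integrable_near_part[OF h int order_refl, of t]])
  show "AE v in lborel. norm ((1 + (v - t)\<^sup>2) * (far_side h t v * exp (- (v - t)\<^sup>2 / (2 * 1\<^sup>2))))
      \<le> norm ((1 + (v - t)\<^sup>2) * ((\<bar>h v\<bar> + \<bar>h (- v)\<bar>) * exp (- (v - t)\<^sup>2 / 2 + 0 * \<bar>v - t\<bar>)))"
    by (rule AE_I2) (auto simp: abs_mult far_side_def intro!: mult_left_mono mult_right_mono)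
qed measurable

text \<open>If the loss is defined at some point of norm \<open>r\<close>, then \<open>far_integrable\<close> holds for every \<open>\<rho> < r\<close>: for
acute angles the label agrees with the sign of \<open>v - t\<close> with a probability bounded below, and the
polynomial factor is absorbed by the gap between \<open>\<rho>\<close> and \<open>r\<close>.\<close>

lemma far_integrable_of_loss_kernel:
  fixes h :: "real \<Rightarrow> real"
  assumes h[measurable]: "h \<in> borel_measurable borel"
    and ab: "0 < a" "a \<le> \<theta>" "\<theta> < pi / 2"
    and rho: "0 < \<rho>" "\<rho> < r"
    and int: "integrable lborel (loss_kernel (\<lambda>v. \<bar>h v\<bar>) t r \<theta>)"
  shows "far_integrable h t \<rho>"
proof -
  define p where "p = Phi (- (\<bar>t\<bar> / sin a))"
  have p: "0 < p" by (simp add: p_def Phi_pos)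
  define \<eta> where "\<eta> = 1 / (2 * \<rho>\<^sup>2) - 1 / (2 * r\<^sup>2)"
  have "\<rho>\<^sup>2 < r\<^sup>2" using rho by (simp add: power_strict_mono)
  then have \<eta>: "0 < \<eta>"
    using rho by (simp add: \<eta>_def frac_less2)
  define c where "c = max 1 (1 / \<eta>) * (sqrt (2 * pi) * r / p)"
  have r: "0 < r" using rho by simp
  have sina: "0 < sin a" "sin a \<le> sin \<theta>"
    using ab by (auto intro!: sin_gt_zero sin_monotone_2pi_le)
  have cos: "0 \<le> cos \<theta>" using ab by (intro cos_ge_zero) auto
  have "integrable lborel (\<lambda>v. c * loss_kernel (\<lambda>v. \<bar>h v\<bar>) t r \<theta> v)"
    using int by (rule integrable_mult_right)
  then show ?thesis
    unfolding far_integrable_def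
  proof (rule Bochner_Integration.integrable_bound)
    show "AE v in lborel. norm ((1 + (v - t)\<^sup>2) * (far_side h t v * exp (- (v - t)\<^sup>2 / (2 * \<rho>\<^sup>2))))
      \<le> norm (c * loss_kernel (\<lambda>v. \<bar>h v\<bar>) t r \<theta> v)"
    proof (rule AE_I2)
      fix v
      define y where "y = (v - t)\<^sup>2"
      define q where "q = thr t r \<theta> v"
      have y: "0 \<le> y" by (simp add: y_def)
      have tq: "\<bar>t / sin \<theta>\<bar> \<le> \<bar>t\<bar> / sin a"
        using sina by (auto simp: abs_divide intro!: frac_le)
      have q: "q = t / sin \<theta> + cos \<theta> * ((v - t) / r) / sin \<theta>"
        by (simp add: q_def thr_def add_divide_distrib)
      have far: "p * far_side h t v \<le> \<bar>h (- v)\<bar> * Phi q + \<bar>h v\<bar> * Phi (- q)"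
      proof (cases "t \<le> v")
        case True
        then have "0 \<le> cos \<theta> * ((v - t) / r) / sin \<theta>"
          using cos r sina by (intro divide_nonneg_nonneg mult_nonneg_nonneg) auto
        then have "- (\<bar>t\<bar> / sin a) \<le> q"
          using tq unfolding q by linarith
        then have "p \<le> Phi q"
          unfolding p_def by (rule Phi_mono)
        then have "\<bar>h (- v)\<bar> * p \<le> \<bar>h (- v)\<bar> * Phi q"
          by (intro mult_left_mono) auto
        moreover have "0 \<le> \<bar>h v\<bar> * Phi (- q)" by simp
        moreover have "p * far_side h t v = \<bar>h (- v)\<bar> * p"
          using True by (simp add: far_side_def)
        ultimately show ?thesis by linarith
      next
        case False
        then have "cos \<theta> * ((v - t) / r) / sin \<theta> \<le> 0"
          using cos r sina by (intro divide_nonpos_nonneg mult_nonneg_nonpos) auto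
        then have "- (\<bar>t\<bar> / sin a) \<le> - q"
          using tq unfolding q by linarith
        then have "p \<le> Phi (- q)"
          unfolding p_def by (rule Phi_mono)
        then have "\<bar>h v\<bar> * p \<le> \<bar>h v\<bar> * Phi (- q)"
          by (intro mult_left_mono) auto
        moreover have "0 \<le> \<bar>h (- v)\<bar> * Phi q" by simp
        moreover have "p * far_side h t v = \<bar>h v\<bar> * p"
          using False by (simp add: far_side_def)
        ultimately show ?thesis by linarith
      qed
      have "1 + y \<le> max 1 (1 / \<eta>) * (1 + \<eta> * y)"
      proof -
        have "1 + y = 1 * 1 + (1 / \<eta>) * (\<eta> * y)"
          using \<eta> by simp
        also have "\<dots> \<le> max 1 (1 / \<eta>) * 1 + max 1 (1 / \<eta>) * (\<eta> * y)"
          using \<eta> y by (intro add_mono mult_right_mono) auto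
        finally show ?thesis by (simp add: distrib_left)
      qed
      also have "\<dots> \<le> max 1 (1 / \<eta>) * exp (\<eta> * y)"
        by (intro mult_left_mono exp_ge_add_one_self) auto
      finally have "(1 + y) * exp (- y / (2 * \<rho>\<^sup>2)) \<le> max 1 (1 / \<eta>) * exp (\<eta> * y) * exp (- y / (2 * \<rho>\<^sup>2))"
        by (intro mult_right_mono) auto
      also have "\<dots> = max 1 (1 / \<eta>) * exp (- y / (2 * r\<^sup>2))"
        by (simp add: \<eta>_def algebra_simps flip: exp_add)
      also have "exp (- y / (2 * r\<^sup>2)) = sqrt (2 * pi) * std_normal_density ((v - t) / r)"
        using r by (simp add: std_normal_density_def y_def power_divide)
      finally have e: "(1 + y) * exp (- y / (2 * \<rho>\<^sup>2))
          \<le> max 1 (1 / \<eta>) * (sqrt (2 * pi) * std_normal_density ((v - t) / r))" .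
      have "(1 + y) * (far_side h t v * exp (- y / (2 * \<rho>\<^sup>2)))
          = ((1 + y) * exp (- y / (2 * \<rho>\<^sup>2))) * far_side h t v"
        by simp
      also have "\<dots> \<le> (max 1 (1 / \<eta>) * (sqrt (2 * pi) * std_normal_density ((v - t) / r))) * far_side h t v"
        using e by (intro mult_right_mono) (auto simp: far_side_def)
      also have "\<dots> = (max 1 (1 / \<eta>) * (sqrt (2 * pi) * std_normal_density ((v - t) / r)) / p) * (p * far_side h t v)"
        using p by simp
      also have "\<dots> \<le> (max 1 (1 / \<eta>) * (sqrt (2 * pi) * std_normal_density ((v - t) / r)) / p)
          * (\<bar>h (- v)\<bar> * Phi q + \<bar>h v\<bar> * Phi (- q))"
        using far p by (intro mult_left_mono) auto
      also have "\<dots> = c * loss_kernel (\<lambda>v. \<bar>h v\<bar>) t r \<theta> v"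
        using r by (simp add: c_def loss_kernel_def q_def)
      finally have "(1 + y) * (far_side h t v * exp (- y / (2 * \<rho>\<^sup>2))) \<le> c * loss_kernel (\<lambda>v. \<bar>h v\<bar>) t r \<theta> v" .
      moreover have "0 \<le> (1 + y) * (far_side h t v * exp (- y / (2 * \<rho>\<^sup>2)))"
        using y by (auto simp: far_side_def)
      ultimately show "norm ((1 + (v - t)\<^sup>2) * (far_side h t v * exp (- (v - t)\<^sup>2 / (2 * \<rho>\<^sup>2))))
          \<le> norm (c * loss_kernel (\<lambda>v. \<bar>h v\<bar>) t r \<theta> v)"
        unfolding y_def real_norm_def by linarith
    qed
  qed measurable
qed

section \<open>The angular derivative of the loss\<close>

lemma borel_measurable_loss_kernel [measurable]:
  assumes [measurable]: "h \<in> borel_measurable borel"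
  shows "loss_kernel h t r \<theta> \<in> borel_measurable borel"
    and "loss_kernel_angle_deriv h t r \<theta> \<in> borel_measurable borel"
  unfolding loss_kernel_def[abs_def] loss_kernel_angle_deriv_def[abs_def] thr_def by measurable

text \<open>The substitution \<open>v = r sin \<theta> w + t (1 - r cos \<theta>)\<close> diagonalises the quadratic form in the exponent of the two
densities and centres the resulting Gaussian.\<close>

lemma integral_angle_deriv_eq:
  fixes h :: "real \<Rightarrow> real" and t :: real
  assumes h[measurable]: "h \<in> borel_measurable borel"
    and r: "0 < r" and s: "0 < sin \<theta>"
  defines "G \<equiv> \<lambda>w. (h (r * sin \<theta> * w + t * (1 - r * cos \<theta>)) - h (- (r * sin \<theta> * w + t * (1 - r * cos \<theta>))))
      * (std_normal_density w * w)"
  shows "integrable lborel (loss_kernel_angle_deriv h t r \<theta>) \<longleftrightarrow> integrable lborel G"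
    and "(\<integral>v. loss_kernel_angle_deriv h t r \<theta> v \<partial>lborel) = std_normal_density t * (\<integral>w. G w \<partial>lborel)"
proof -
  let ?c = "r * sin \<theta>" and ?b = "t * (1 - r * cos \<theta>)"
  have c: "?c \<noteq> 0" "\<bar>?c\<bar> = ?c" using r s by auto
  have eq: "\<bar>?c\<bar> *\<^sub>R loss_kernel_angle_deriv h t r \<theta> (?b + ?c * w) = std_normal_density t * G w" for w
  proof -
    define v where "v = ?b + ?c * w"
    have U: "(v - t) / r = sin \<theta> * w - t * cos \<theta>"
      using r by (simp add: v_def field_simps)
    have q: "thr t r \<theta> v = t * sin \<theta> + cos \<theta> * w"
    proof -
      have "t + cos \<theta> * (sin \<theta> * w - t * cos \<theta>) = t * ((sin \<theta>)\<^sup>2 + (cos \<theta>)\<^sup>2) + cos \<theta> * (sin \<theta> * w - t * cos \<theta>)"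
        by simp
      also have "\<dots> = (t * sin \<theta> + cos \<theta> * w) * sin \<theta>"
        unfolding power2_eq_square by (simp only: ring_distribs right_diff_distrib) (simp add: ac_simps)
      finally show ?thesis
        using s by (simp add: thr_def U)
    qed
    have sq: "(sin \<theta> * w - t * cos \<theta>)\<^sup>2 + (t * sin \<theta> + cos \<theta> * w)\<^sup>2 = t\<^sup>2 + w\<^sup>2"
    proof -
      have "(sin \<theta> * w - t * cos \<theta>)\<^sup>2 + (t * sin \<theta> + cos \<theta> * w)\<^sup>2 = ((sin \<theta>)\<^sup>2 + (cos \<theta>)\<^sup>2) * (t\<^sup>2 + w\<^sup>2)"
        unfolding power2_eq_square by algebra
      then show ?thesis by simp
    qed
    have dens: "std_normal_density a * std_normal_density b = std_normal_density c * std_normal_density d"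
      if "a\<^sup>2 + b\<^sup>2 = c\<^sup>2 + d\<^sup>2" for a b c d
    proof -
      have "exp (- a\<^sup>2 / 2) * exp (- b\<^sup>2 / 2) = exp (- (a\<^sup>2 + b\<^sup>2) / 2)"
        by (simp add: add_divide_distrib flip: exp_add)
      also have "\<dots> = exp (- c\<^sup>2 / 2) * exp (- d\<^sup>2 / 2)"
        unfolding that by (simp add: add_divide_distrib flip: exp_add)
      finally show ?thesis
        by (simp add: std_normal_density_def)
    qed
    have "loss_kernel_angle_deriv h t r \<theta> v = (h v - h (- v)) *
        (std_normal_density (sin \<theta> * w - t * cos \<theta>) * std_normal_density (t * sin \<theta> + cos \<theta> * w)) / r * (w / sin \<theta>)"
      using s by (simp add: loss_kernel_angle_deriv_def U q power2_eq_square)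
    also have "\<dots> = (h v - h (- v)) * (std_normal_density t * std_normal_density w) / r * (w / sin \<theta>)"
      by (simp only: dens[OF sq])
    finally have "?c * loss_kernel_angle_deriv h t r \<theta> v = std_normal_density t * ((h v - h (- v)) * (std_normal_density w * w))"
      using r s by simp
    then show ?thesis
      unfolding c(2) by (simp add: G_def v_def add.commute)
  qed
  have int1: "integrable lborel (loss_kernel_angle_deriv h t r \<theta>) \<longleftrightarrow>
      integrable lborel (\<lambda>w. \<bar>?c\<bar> *\<^sub>R loss_kernel_angle_deriv h t r \<theta> (?b + ?c * w))"
    using c lborel_integrable_real_affine_iff[OF c(1), of "loss_kernel_angle_deriv h t r \<theta>" ?b] by simp
  have dt: "std_normal_density t \<noteq> 0"
    using normal_density_pos[of 1 0 t] by simp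
  show "integrable lborel (loss_kernel_angle_deriv h t r \<theta>) \<longleftrightarrow> integrable lborel G"
    unfolding int1 eq using dt by (simp only: integrable_mult_left_iff) simp
  have "(\<integral>v. loss_kernel_angle_deriv h t r \<theta> v \<partial>lborel)
      = (\<integral>w. \<bar>?c\<bar> *\<^sub>R loss_kernel_angle_deriv h t r \<theta> (?b + ?c * w) \<partial>lborel)"
    using lborel_integral_real_affine[OF c(1), of "loss_kernel_angle_deriv h t r \<theta>" ?b] by simp
  then show "(\<integral>v. loss_kernel_angle_deriv h t r \<theta> v \<partial>lborel) = std_normal_density t * (\<integral>w. G w \<partial>lborel)"
    unfolding eq by simp
qed

text \<open>Since \<open>w \<phi>(w)\<close> has integral zero, \<open>H (a w + b)\<close> may be replaced by \<open>H (a w + b) - H b\<close>, which has the sign of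
\<open>w\<close>. The nonnegative integrand is then bounded below on \<open>{1..2}\<close>, uniformly for \<open>(a, b)\<close> near \<open>(a0, b0)\<close>.\<close>

lemma integral_mult_normal_ge:
  fixes H :: "real \<Rightarrow> real"
  assumes H: "strict_mono H"
    and a0: "0 < a0" and a: "\<bar>a - a0\<bar> \<le> a0 / 4" and b: "\<bar>b - b0\<bar> \<le> a0 / 4"
    and int: "integrable lborel (\<lambda>w. H (a * w + b) * (std_normal_density w * w))"
  shows "(H (b0 + a0 / 2) - H (b0 + a0 / 4)) * std_normal_density 2
     \<le> (\<integral>w. H (a * w + b) * (std_normal_density w * w) \<partial>lborel)"
proof -
  define d where "d = (H (b0 + a0 / 2) - H (b0 + a0 / 4)) * std_normal_density 2"
  have mono: "x \<le> y \<Longrightarrow> H x \<le> H y" for x y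
    using H by (simp add: strict_mono_less_eq)
  have a_pos: "0 < a" using a a0 by linarith
  have "has_bochner_integral lborel (\<lambda>w. std_normal_density w * w ^ (2 * 0 + 1)) 0"
    by (rule std_normal_moment_odd)
  then have zero: "integrable lborel (\<lambda>w. std_normal_density w * w)" "(\<integral>w. std_normal_density w * w \<partial>lborel) = 0"
    by (auto simp: has_bochner_integral_iff)
  have "d = (\<integral>w. d * indicator {1..2::real} w \<partial>lborel)"
    by simp
  also have "\<dots> \<le> (\<integral>w. H (a * w + b) * (std_normal_density w * w) - H b * (std_normal_density w * w) \<partial>lborel)"
  proof (rule integral_mono)
    show "integrable lborel (\<lambda>w. d * indicator {1..2::real} w)"
      by (intro integrable_mult_right integrable_real_indicator) auto
    show "integrable lborel (\<lambda>w. H (a * w + b) * (std_normal_density w * w) - H b * (std_normal_density w * w))"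
      using int zero(1) by (intro Bochner_Integration.integrable_diff integrable_mult_right)
    fix w :: real
    have e: "H (a * w + b) * (std_normal_density w * w) - H b * (std_normal_density w * w)
       = std_normal_density w * (w * (H (a * w + b) - H b))"
      by (simp add: algebra_simps)
    show "d * indicator {1..2} w \<le> H (a * w + b) * (std_normal_density w * w) - H b * (std_normal_density w * w)"
    proof (cases "w \<in> {1..2}")
      case True
      have "3 / 4 * a0 \<le> a" using a by linarith
      also have "a \<le> a * w" using True a_pos by simp
      finally have "b0 + a0 / 2 \<le> a * w + b" using b by linarith
      then have "H (b0 + a0 / 2) \<le> H (a * w + b)" by (rule mono)
      moreover have "H b \<le> H (b0 + a0 / 4)" using b by (intro mono) linarith
      ultimately have h: "H (b0 + a0 / 2) - H (b0 + a0 / 4) \<le> H (a * w + b) - H b" by linarith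
      moreover have h0: "0 \<le> H (b0 + a0 / 2) - H (b0 + a0 / 4)"
        using a0 by (simp add: mono)
      ultimately have "H (b0 + a0 / 2) - H (b0 + a0 / 4) \<le> w * (H (a * w + b) - H b)"
        using True mult_right_mono[of 1 w "H (a * w + b) - H b"] by auto
      moreover have "std_normal_density 2 \<le> std_normal_density w"
      proof -
        have "w\<^sup>2 \<le> 2\<^sup>2" using True by (intro power_mono) auto
        then show ?thesis
          unfolding std_normal_density_def by (intro mult_left_mono) auto
      qed
      ultimately have "std_normal_density 2 * (H (b0 + a0 / 2) - H (b0 + a0 / 4))
          \<le> std_normal_density w * (w * (H (a * w + b) - H b))"
        using h0 by (intro mult_mono) auto
      then show ?thesis
        unfolding e using True by (simp add: d_def mult.commute)
    next
      case False
      have "0 \<le> w * (H (a * w + b) - H b)"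
      proof (cases "0 \<le> w")
        case True
        then have "H b \<le> H (a * w + b)"
          using a_pos by (intro mono) simp
        then show ?thesis
          using True by simp
      next
        case False
        then have "a * w \<le> 0"
          using a_pos by (intro mult_nonneg_nonpos) auto
        then have "H (a * w + b) \<le> H b"
          by (intro mono) simp
        then show ?thesis
          using False by (intro mult_nonpos_nonpos) auto
      qed
      then show ?thesis
        unfolding e using False by simp
    qed
  qed
  also have "\<dots> = (\<integral>w. H (a * w + b) * (std_normal_density w * w) \<partial>lborel)"
    using int zero by simp
  finally show ?thesis
    by (simp add: d_def)
qed

lemma majorant_abs: "majorant (\<lambda>v. \<bar>h v\<bar>) = majorant h"
  by (simp add: majorant_def far_side_def fun_eq_iff cong: if_cong)

text \<open>The integrals of the kernels over the rectangle \<open>r \<in> {1/2..\<rho>}\<close>, \<open>\<theta> \<in> {a..b}\<close>, under the condition that makes their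
majorant integrable.\<close>

locale loss_family =
  fixes h :: "real \<Rightarrow> real" and t a b \<rho> :: real
  assumes h[measurable]: "h \<in> borel_measurable borel"
    and gauss: "\<And>c. integrable std_normal_distribution (\<lambda>s. \<bar>h (c + s)\<bar>)"
    and ab: "0 < a" "a < b" "b < pi / 2"
    and rho: "1 \<le> \<rho>" "\<rho>\<^sup>2 \<le> 1 + (cot b)\<^sup>2"
    and far: "far_integrable h t \<rho>"
begin

text \<open>The majorant with the constant \<open>A\<close> of \<open>loss_kernel_majorised\<close>.\<close>

definition maj :: "real \<Rightarrow> real" where
  "maj = majorant h t (2 * (cot b * \<bar>t\<bar> / sin a)) \<rho>"

lemma sin_pos: "a \<le> \<theta> \<Longrightarrow> \<theta> \<le> b \<Longrightarrow> 0 < sin \<theta>"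
  using ab by (intro sin_gt_zero) auto

lemma integrable_maj: "integrable lborel maj"
proof -
  have "0 \<le> cot b"
    using ab by (auto simp: cot_def intro!: divide_nonneg_nonneg cos_ge_zero sin_ge_zero)
  then have "0 \<le> 2 * (cot b * \<bar>t\<bar> / sin a)"
    using sin_pos[of a] ab by simp
  then show ?thesis
    unfolding maj_def using h gauss far by (intro integrable_majorant)
qed

lemma maj_nonneg: "0 \<le> maj v"
  by (simp add: maj_def majorant_nonneg)

lemma ex_bound:
  "\<exists>C\<ge>0. \<forall>r \<theta> v. 1 / 2 \<le> r \<longrightarrow> r \<le> \<rho> \<longrightarrow> a \<le> \<theta> \<longrightarrow> \<theta> \<le> b \<longrightarrow>
     \<bar>loss_kernel h t r \<theta> v\<bar> \<le> C * maj v \<and> \<bar>loss_kernel (\<lambda>v. \<bar>h v\<bar>) t r \<theta> v\<bar> \<le> C * maj v \<and>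
     \<bar>loss_kernel_radial_deriv h t r \<theta> v\<bar> \<le> C * maj v \<and>
     \<bar>loss_kernel_angle_deriv h t r \<theta> v\<bar> \<le> C * maj v"
proof -
  obtain C where "C \<ge> 0" and C: "\<forall>h \<rho> r \<theta> v. 1 \<le> \<rho> \<longrightarrow> \<rho>\<^sup>2 \<le> 1 + (cot b)\<^sup>2 \<longrightarrow> 1 / 2 \<le> r \<longrightarrow> r \<le> \<rho> \<longrightarrow> a \<le> \<theta> \<longrightarrow> \<theta> \<le> b \<longrightarrow>
     \<bar>loss_kernel h t r \<theta> v\<bar> \<le> C * majorant h t (2 * (cot b * \<bar>t\<bar> / sin a)) \<rho> v \<and>
     \<bar>loss_kernel_radial_deriv h t r \<theta> v\<bar> \<le> C * majorant h t (2 * (cot b * \<bar>t\<bar> / sin a)) \<rho> v \<and>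
     \<bar>loss_kernel_angle_deriv h t r \<theta> v\<bar> \<le> C * majorant h t (2 * (cot b * \<bar>t\<bar> / sin a)) \<rho> v"
    using loss_kernel_majorised[of a b t] ab by auto
  have "\<bar>loss_kernel (\<lambda>v. \<bar>h v\<bar>) t r \<theta> v\<bar> \<le> C * maj v"
    if "1 / 2 \<le> r" "r \<le> \<rho>" "a \<le> \<theta>" "\<theta> \<le> b" for r \<theta> v
    using C[rule_format, OF rho that, of "\<lambda>v. \<bar>h v\<bar>" v] by (simp add: majorant_abs maj_def)
  moreover note C[rule_format, OF rho, where h = h, folded maj_def]
  ultimately show ?thesis
    using \<open>C \<ge> 0\<close> by blast
qed

lemma integrable_loss_kernel:
  assumes "1 / 2 \<le> r" "r \<le> \<rho>" "a \<le> \<theta>" "\<theta> \<le> b"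
  shows "integrable lborel (loss_kernel h t r \<theta>)" (is ?A)
    and "integrable lborel (loss_kernel (\<lambda>v. \<bar>h v\<bar>) t r \<theta>)" (is ?B)
    and "integrable lborel (loss_kernel_angle_deriv h t r \<theta>)" (is ?C)
proof -
  obtain C where C: "C \<ge> 0" "\<And>v. \<bar>loss_kernel h t r \<theta> v\<bar> \<le> C * maj v"
     "\<And>v. \<bar>loss_kernel (\<lambda>v. \<bar>h v\<bar>) t r \<theta> v\<bar> \<le> C * maj v"
     "\<And>v. \<bar>loss_kernel_angle_deriv h t r \<theta> v\<bar> \<le> C * maj v"
    using ex_bound assms by blast
  have i: "integrable lborel (\<lambda>v. C * maj v)"
    using integrable_maj by (rule integrable_mult_right)
  have le: "norm y \<le> norm (C * maj v)" if "\<bar>y\<bar> \<le> C * maj v" for y v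
    using that by simp
  show ?A by (rule Bochner_Integration.integrable_bound[OF i _ AE_I2[OF le[OF C(2)]]]) measurable
  show ?B by (rule Bochner_Integration.integrable_bound[OF i _ AE_I2[OF le[OF C(3)]]]) measurable
  show ?C by (rule Bochner_Integration.integrable_bound[OF i _ AE_I2[OF le[OF C(4)]]]) measurable
qed

lemma lipschitz_integral:
  "\<exists>L\<ge>0. \<forall>r \<theta> r' \<theta>'. 1 / 2 \<le> r \<longrightarrow> r \<le> \<rho> \<longrightarrow> a \<le> \<theta> \<longrightarrow> \<theta> \<le> b \<longrightarrow>
     1 / 2 \<le> r' \<longrightarrow> r' \<le> \<rho> \<longrightarrow> a \<le> \<theta>' \<longrightarrow> \<theta>' \<le> b \<longrightarrow>
     \<bar>(\<integral>v. loss_kernel h t r \<theta> v \<partial>lborel) - (\<integral>v. loss_kernel h t r' \<theta>' v \<partial>lborel)\<bar> \<le> L * (\<bar>r - r'\<bar> + \<bar>\<theta> - \<theta>'\<bar>)"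
proof -
  obtain C where C0: "C \<ge> 0" and C: "\<And>r \<theta> v. 1 / 2 \<le> r \<Longrightarrow> r \<le> \<rho> \<Longrightarrow> a \<le> \<theta> \<Longrightarrow> \<theta> \<le> b \<Longrightarrow>
     \<bar>loss_kernel_radial_deriv h t r \<theta> v\<bar> \<le> C * maj v \<and> \<bar>loss_kernel_angle_deriv h t r \<theta> v\<bar> \<le> C * maj v"
    using ex_bound by blast
  define L where "L = C * (\<integral>v. maj v \<partial>lborel)"
  have L0: "0 \<le> L"
    unfolding L_def by (rule mult_nonneg_nonneg[OF C0 Bochner_Integration.integral_nonneg[OF maj_nonneg]])
  have "\<bar>(\<integral>v. loss_kernel h t r \<theta> v \<partial>lborel) - (\<integral>v. loss_kernel h t r' \<theta>' v \<partial>lborel)\<bar> \<le> L * (\<bar>r - r'\<bar> + \<bar>\<theta> - \<theta>'\<bar>)"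
    if p: "1 / 2 \<le> r" "r \<le> \<rho>" "a \<le> \<theta>" "\<theta> \<le> b" and p': "1 / 2 \<le> r'" "r' \<le> \<rho>" "a \<le> \<theta>'" "\<theta>' \<le> b" for r \<theta> r' \<theta>'
  proof -
    let ?K = "loss_kernel h t"
    have "\<bar>?K r \<theta> v - ?K r' \<theta>' v\<bar> \<le> C * maj v * (\<bar>r - r'\<bar> + \<bar>\<theta> - \<theta>'\<bar>)" for v
    proof -
      have "norm (?K r \<theta> v - ?K r' \<theta> v) \<le> C * maj v * norm (r - r')"
      proof (rule field_differentiable_bound[where S="{1 / 2..\<rho>}" and f="\<lambda>r. ?K r \<theta> v" and f'="\<lambda>s. loss_kernel_radial_deriv h t s \<theta> v"])
        show "((\<lambda>r. ?K r \<theta> v) has_real_derivative loss_kernel_radial_deriv h t s \<theta> v) (at s within {1 / 2..\<rho>})"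
          if "s \<in> {1 / 2..\<rho>}" for s
          using that by (intro has_field_derivative_at_within[OF DERIV_loss_kernel_radial]) auto
      qed (use p p' C in auto)
      moreover have "norm (?K r' \<theta> v - ?K r' \<theta>' v) \<le> C * maj v * norm (\<theta> - \<theta>')"
      proof (rule field_differentiable_bound[where S="{a..b}" and f="\<lambda>\<theta>. ?K r' \<theta> v" and f'="\<lambda>s. loss_kernel_angle_deriv h t r' s v"])
        show "((\<lambda>\<theta>. ?K r' \<theta> v) has_real_derivative loss_kernel_angle_deriv h t r' s v) (at s within {a..b})"
          if "s \<in> {a..b}" for s
          using that sin_pos[of s] by (intro has_field_derivative_at_within[OF DERIV_loss_kernel_angle]) auto
      qed (use p p' C in auto)
      ultimately show ?thesis
        unfolding distrib_left real_norm_def by linarith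
    qed
    then have "\<bar>\<integral>v. ?K r \<theta> v - ?K r' \<theta>' v \<partial>lborel\<bar> \<le> (\<integral>v. C * maj v * (\<bar>r - r'\<bar> + \<bar>\<theta> - \<theta>'\<bar>) \<partial>lborel)"
      using integrable_maj integrable_loss_kernel(1)[OF p] integrable_loss_kernel(1)[OF p']
      by (intro order_trans[OF integral_abs_bound] integral_mono) auto
    then show ?thesis
      using integrable_loss_kernel(1)[OF p] integrable_loss_kernel(1)[OF p'] by (simp add: L_def)
  qed
  then show ?thesis
    using L0 by blast
qed

lemma DERIV_integral_angle:
  assumes r: "1 / 2 \<le> r" "r \<le> \<rho>" and th: "a < \<theta>" "\<theta> < b"
  shows "((\<lambda>\<theta>. \<integral>v. loss_kernel h t r \<theta> v \<partial>lborel) has_real_derivative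
    (\<integral>v. loss_kernel_angle_deriv h t r \<theta> v \<partial>lborel)) (at \<theta>)"
proof -
  let ?K = "loss_kernel h t r"
  obtain C where C0: "C \<ge> 0" and C: "\<And>\<theta> v. a \<le> \<theta> \<Longrightarrow> \<theta> \<le> b \<Longrightarrow> \<bar>loss_kernel_angle_deriv h t r \<theta> v\<bar> \<le> C * maj v"
    using ex_bound r by blast
  \<comment> \<open>By the mean value theorem the difference quotients obey the bound on the derivative.\<close>
  have lip: "\<bar>(?K \<phi> v - ?K \<theta> v) / (\<phi> - \<theta>)\<bar> \<le> C * maj v" if ph: "a \<le> \<phi>" "\<phi> \<le> b" for \<phi> v
  proof -
    have "norm (?K \<phi> v - ?K \<theta> v) \<le> C * maj v * norm (\<phi> - \<theta>)"
    proof (rule field_differentiable_bound[where S="{a..b}" and f="\<lambda>\<theta>. ?K \<theta> v" and f'="\<lambda>s. loss_kernel_angle_deriv h t r s v"])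
      show "((\<lambda>\<theta>. ?K \<theta> v) has_real_derivative loss_kernel_angle_deriv h t r s v) (at s within {a..b})"
        if "s \<in> {a..b}" for s
        using that sin_pos[of s] by (intro has_field_derivative_at_within[OF DERIV_loss_kernel_angle]) auto
    qed (use th ph C in auto)
    then show ?thesis
      using C0 maj_nonneg[of v] by (cases "\<phi> = \<theta>") (auto simp: abs_divide divide_le_eq)
  qed
  have "((\<lambda>\<phi>. ((\<integral>v. ?K \<phi> v \<partial>lborel) - (\<integral>v. ?K \<theta> v \<partial>lborel)) / (\<phi> - \<theta>)) \<longlongrightarrow>
    (\<integral>v. loss_kernel_angle_deriv h t r \<theta> v \<partial>lborel)) (at \<theta> within {a..b})"
    unfolding tendsto_at_iff_sequentially
  proof (intro allI impI)
    fix X :: "nat \<Rightarrow> real"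
    assume X: "\<forall>i. X i \<in> {a..b} - {\<theta>}" "X \<longlonglongrightarrow> \<theta>"
    have lim: "(\<lambda>i. \<integral>v. (?K (X i) v - ?K \<theta> v) / (X i - \<theta>) \<partial>lborel) \<longlonglongrightarrow> (\<integral>v. loss_kernel_angle_deriv h t r \<theta> v \<partial>lborel)"
    proof (rule integral_dominated_convergence[where w="\<lambda>v. C * maj v"])
      show "integrable lborel (\<lambda>v. C * maj v)"
        using integrable_maj by (rule integrable_mult_right)
      show "AE v in lborel. norm ((?K (X i) v - ?K \<theta> v) / (X i - \<theta>)) \<le> C * maj v" for i
        using X lip[of "X i"] by (intro AE_I2) auto
      show "AE v in lborel. (\<lambda>i. (?K (X i) v - ?K \<theta> v) / (X i - \<theta>)) \<longlonglongrightarrow> loss_kernel_angle_deriv h t r \<theta> v"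
      proof (rule AE_I2)
        fix v
        have "((\<lambda>\<theta>. ?K \<theta> v) has_real_derivative loss_kernel_angle_deriv h t r \<theta> v) (at \<theta>)"
          using sin_pos[of \<theta>] th by (intro DERIV_loss_kernel_angle) auto
        then have "((\<lambda>\<phi>. (?K \<phi> v - ?K \<theta> v) / (\<phi> - \<theta>)) \<longlongrightarrow> loss_kernel_angle_deriv h t r \<theta> v) (at \<theta>)"
          by (simp add: has_field_derivative_iff)
        then show "(\<lambda>i. (?K (X i) v - ?K \<theta> v) / (X i - \<theta>)) \<longlonglongrightarrow> loss_kernel_angle_deriv h t r \<theta> v"
          unfolding tendsto_at_iff_sequentially using X by (auto simp: comp_def)
      qed
    qed measurable
    have eq: "(\<integral>v. (?K (X i) v - ?K \<theta> v) / (X i - \<theta>) \<partial>lborel)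
        = ((\<integral>v. ?K (X i) v \<partial>lborel) - (\<integral>v. ?K \<theta> v \<partial>lborel)) / (X i - \<theta>)" for i
      using X integrable_loss_kernel(1)[of r "X i"] integrable_loss_kernel(1)[of r \<theta>] r th by simp
    show "((\<lambda>\<phi>. ((\<integral>v. ?K \<phi> v \<partial>lborel) - (\<integral>v. ?K \<theta> v \<partial>lborel)) / (\<phi> - \<theta>)) \<circ> X) \<longlonglongrightarrow>
      (\<integral>v. loss_kernel_angle_deriv h t r \<theta> v \<partial>lborel)"
      using lim unfolding eq by (simp only: comp_def)
  qed
  moreover have "at \<theta> within {a..b} = at \<theta>"
    using th by (intro at_within_Icc_at)
  ultimately show ?thesis
    by (simp add: has_field_derivative_iff)
qed

end

section \<open>The class \<open>H_plus\<close>\<close>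

lemma H_plus_continuous:
  assumes "h \<in> H_plus"
  shows "isCont h s"
  using assms by (intro locally_lipschitz_at_imp_isCont) (auto simp: H_plus_def)

lemma H_plus_measurable:
  assumes "h \<in> H_plus"
  shows "h \<in> borel_measurable borel"
  using H_plus_continuous[OF assms]
  by (intro borel_measurable_continuous_onI continuous_at_imp_continuous_on) auto

lemma H_plus_integrable:
  assumes h: "h \<in> H_plus"
  shows "integrable std_normal_distribution (\<lambda>s. \<bar>h (a + s)\<bar>)"
proof -
  note [measurable] = H_plus_measurable[OF h]
  have "integrable std_normal_distribution (\<lambda>s. \<bar>h (a + s)\<bar> + \<bar>deriv h (a + s)\<bar>)"
    using h by (auto simp: H_plus_def)
  then show ?thesis
    by (rule Bochner_Integration.integrable_bound) auto
qed

text \<open>The derivative of \<open>h u - h (- u)\<close> at \<open>s > 0\<close> is \<open>h' s + h' (- s) > 0\<close>; the negative half-line follows because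
the function is odd.\<close>

lemma H_plus_odd_part_strict_mono:
  assumes h: "h \<in> H_plus"
  shows "strict_mono (\<lambda>u. h u - h (- u))"
proof -
  let ?H = "\<lambda>u. h u - h (- u)"
  have lip: "locally_lipschitz_at UNIV h s" for s
    using h by (simp add: H_plus_def)
  have lipH: "locally_lipschitz_at UNIV ?H s" for s
  proof -
    obtain e L where e: "e > 0" "L-lipschitz_on (ball s e) h"
      using lip[of s] by (auto simp: locally_lipschitz_at_def)
    obtain e' L' where e': "e' > 0" "L'-lipschitz_on (ball (- s) e') h"
      using lip[of "- s"] by (auto simp: locally_lipschitz_at_def)
    have "(L + L')-lipschitz_on (ball s (min e e')) ?H"
    proof (rule lipschitz_onI)
      show "0 \<le> L + L'"
        using e e' lipschitz_on_nonneg by (metis add_nonneg_nonneg)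
      fix u v assume uv: "u \<in> ball s (min e e')" "v \<in> ball s (min e e')"
      then have "\<bar>h u - h v\<bar> \<le> L * \<bar>u - v\<bar>"
        using lipschitz_onD[OF e(2), of u v] by (simp add: dist_real_def)
      moreover have "\<bar>h (- u) - h (- v)\<bar> \<le> L' * \<bar>u - v\<bar>"
        using uv lipschitz_onD[OF e'(2), of "- u" "- v"] by (simp add: dist_real_def abs_minus_commute)
      ultimately show "dist (?H u) (?H v) \<le> (L + L') * dist u v"
        unfolding dist_real_def distrib_right by linarith
    qed
    then show ?thesis
      using e e' unfolding locally_lipschitz_at_def by (intro exI[of _ "min e e'"]) auto
  qed
  have "AE s in lborel. 0 < s \<longrightarrow>
      h field_differentiable at s \<and> h field_differentiable at (- s) \<and> deriv h s + deriv h (- s) > 0"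
    using h by (simp add: H_plus_def)
  then have pos: "AE s in lborel. 0 < s \<longrightarrow> (\<exists>D>0. (?H has_real_derivative D) (at s))"
  proof eventually_elim
    case (elim s)
    show ?case
    proof
      assume "0 < s"
      then have d: "(h has_real_derivative deriv h s) (at s)" "(h has_real_derivative deriv h (- s)) (at (- s))"
        and p: "deriv h s + deriv h (- s) > 0"
        using elim by (auto simp: DERIV_deriv_iff_field_differentiable)
      have "((\<lambda>u. h (- u)) has_real_derivative - deriv h (- s)) (at s)"
        using d(2) by (simp add: DERIV_mirror)
      then have "(?H has_real_derivative deriv h s - - deriv h (- s)) (at s)"
        by (intro DERIV_diff d)
      then show "\<exists>D>0. (?H has_real_derivative D) (at s)"
        using p by auto
    qed
  qed
  have right: "?H u < ?H v" if "0 \<le> u" "u < v" for u v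
    using lipH pos that by (rule less_if_locally_lipschitz_deriv_pos)
  show ?thesis
  proof (rule strict_monoI)
    fix u v :: real assume uv: "u < v"
    consider "0 \<le> u" | "u < 0" "0 < v" | "v \<le> 0" by linarith
    then show "?H u < ?H v"
    proof cases
      case 2
      then show ?thesis using right[of 0 "- u"] right[of 0 v] by simp
    next
      case 3
      then show ?thesis using right[of "- v" "- u"] uv by simp
    qed (use right uv in blast)
  qed
qed

section \<open>Polar coordinates with respect to the target direction\<close>

text \<open>The colatitude of \<open>y\<close> for the pole \<open>xs\<close>, that is, the angle between \<open>y\<close> and the unit vector \<open>xs\<close>.\<close>

definition colat :: "real ^ 'n \<Rightarrow> real ^ 'n \<Rightarrow> real" where
  "colat xs y = arccos (xs \<bullet> y / norm y)"

text \<open>The unit vector orthogonal to \<open>xs\<close> in the direction of \<open>y\<close>; it is zero if \<open>y\<close> is a multiple of \<open>xs\<close>.\<close>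

definition meridian :: "real ^ 'n \<Rightarrow> real ^ 'n \<Rightarrow> real ^ 'n" where
  "meridian xs y = sgn (y - (xs \<bullet> y) *\<^sub>R xs)"

lemma polar_coordinates:
  fixes xs y :: "real ^ 'n"
  assumes xs: "norm xs = 1" and y: "\<bar>xs \<bullet> y\<bar> < norm y"
  shows "norm (meridian xs y) = 1" "xs \<bullet> meridian xs y = 0"
    "0 < colat xs y" "colat xs y < pi" "cos (colat xs y) = xs \<bullet> y / norm y"
    "y = norm y *\<^sub>R (cos (colat xs y) *\<^sub>R xs + sin (colat xs y) *\<^sub>R meridian xs y)"
proof -
  let ?d = "y - (xs \<bullet> y) *\<^sub>R xs"
  have y0: "0 < norm y" using y by linarith
  have xx: "xs \<bullet> xs = 1" using xs by (simp add: norm_eq_1)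
  have dd: "?d \<bullet> ?d = (norm y)\<^sup>2 - (xs \<bullet> y)\<^sup>2"
    by (simp add: power2_norm_eq_inner inner_diff_left inner_diff_right xx inner_commute[of y xs] power2_eq_square[of "xs \<bullet> y"])
  have "(xs \<bullet> y)\<^sup>2 < (norm y)\<^sup>2"
    using power_strict_mono[OF y abs_ge_zero, of 2] by simp
  then have d0: "?d \<noteq> 0"
    using dd by auto
  then show m1: "norm (meridian xs y) = 1"
    by (simp add: meridian_def norm_sgn)
  show "xs \<bullet> meridian xs y = 0"
    by (simp add: meridian_def sgn_div_norm inner_diff_right xx)
  have c: "- 1 < xs \<bullet> y / norm y" "xs \<bullet> y / norm y < 1"
    using y y0 by (auto simp: field_simps abs_less_iff)
  show "0 < colat xs y" "colat xs y < pi"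
    using arccos_lt_bounded[OF c] by (simp_all add: colat_def)
  show cosc: "cos (colat xs y) = xs \<bullet> y / norm y"
    using c by (simp add: colat_def cos_arccos)
  have "sin (colat xs y) = sqrt (1 - (xs \<bullet> y / norm y)\<^sup>2)"
    using c by (simp add: colat_def sin_arccos)
  also have "\<dots> = norm ?d / norm y"
  proof -
    have "(norm ?d)\<^sup>2 = (norm y)\<^sup>2 - (xs \<bullet> y)\<^sup>2"
      using dd by (simp add: power2_norm_eq_inner)
    then have "1 - (xs \<bullet> y / norm y)\<^sup>2 = (norm ?d / norm y)\<^sup>2"
      using y0 by (simp add: power_divide field_simps)
    then show ?thesis by simp
  qed
  finally have sinc: "sin (colat xs y) = norm ?d / norm y" .
  have "norm y *\<^sub>R (cos (colat xs y) *\<^sub>R xs + sin (colat xs y) *\<^sub>R meridian xs y)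
      = (xs \<bullet> y) *\<^sub>R xs + norm ?d *\<^sub>R meridian xs y"
    using y0 by (simp add: cosc sinc scaleR_add_right)
  also have "norm ?d *\<^sub>R meridian xs y = ?d"
    using d0 by (simp add: meridian_def sgn_div_norm)
  finally show "y = norm y *\<^sub>R (cos (colat xs y) *\<^sub>R xs + sin (colat xs y) *\<^sub>R meridian xs y)"
    by simp
qed

lemma isCont_polar:
  fixes xs y :: "real ^ 'n"
  assumes xs: "norm xs = 1" and y: "\<bar>xs \<bullet> y\<bar> < norm y"
  shows "isCont (colat xs) y" "isCont (meridian xs) y"
proof -
  have y0: "y \<noteq> 0" using y by auto
  have c: "- 1 < xs \<bullet> y / norm y" "xs \<bullet> y / norm y < 1"
    using y y0 by (auto simp: field_simps abs_less_iff)
  have "isCont (\<lambda>y. xs \<bullet> y / norm y) y"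
    using y0 by (auto intro!: continuous_intros)
  then have "isCont (\<lambda>y. arccos (xs \<bullet> y / norm y)) y"
    using isCont_o2 isCont_arccos[OF c] by blast
  then show "isCont (colat xs) y"
    by (simp add: colat_def[abs_def])
  have "norm (meridian xs y) = 1"
    using polar_coordinates[OF xs y] by simp
  then have "y - (xs \<bullet> y) *\<^sub>R xs \<noteq> 0"
    by (auto simp: meridian_def)
  then show "isCont (meridian xs) y"
    unfolding meridian_def[abs_def] sgn_div_norm by (auto intro!: continuous_intros)
qed

lemma colat_lipschitz:
  fixes xs y z :: "real ^ 'n"
  assumes xs: "norm xs = 1" and y: "\<bar>xs \<bullet> y\<bar> < norm y" "\<bar>xs \<bullet> z\<bar> < norm z"
    and half: "1 / 2 \<le> norm y"
    and ab: "0 < a" "b < pi / 2" "colat xs y \<in> {a..b}" "colat xs z \<in> {a..b}"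
  shows "\<bar>colat xs y - colat xs z\<bar> \<le> 4 / sin a * norm (y - z)"
proof -
  have sina: "0 < sin a"
    using ab by (intro sin_gt_zero) auto
  have cos_diff: "\<bar>u - v\<bar> * sin a \<le> \<bar>cos u - cos v\<bar>" if "u \<in> {a..b}" "v \<in> {a..b}" "u < v" for u v
  proof -
    have "\<exists>z. u < z \<and> z < v \<and> cos v - cos u = (v - u) * - sin z"
      using that by (intro MVT2) auto
    then obtain z where z: "u < z" "z < v" "cos v - cos u = (v - u) * - sin z" by blast
    have "sin a \<le> sin z"
      using z that ab by (intro sin_monotone_2pi_le) auto
    then have "(v - u) * sin a \<le> (v - u) * sin z"
      using that by (intro mult_left_mono) auto
    moreover have "(v - u) * sin z = cos u - cos v" "\<bar>u - v\<bar> = v - u"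
      using z(3) that by auto
    ultimately show ?thesis by simp
  qed
  have "\<bar>colat xs y - colat xs z\<bar> * sin a \<le> \<bar>cos (colat xs y) - cos (colat xs z)\<bar>"
    using cos_diff[of "colat xs y" "colat xs z"] cos_diff[of "colat xs z" "colat xs y"] ab
    by (cases "colat xs y" "colat xs z" rule: linorder_cases) (auto simp: abs_minus_commute)
  also have "\<dots> = \<bar>xs \<bullet> y / norm y - xs \<bullet> z / norm z\<bar>"
    using polar_coordinates(5)[OF xs] y by simp
  also have "xs \<bullet> y / norm y - xs \<bullet> z / norm z
      = (xs \<bullet> (y - z)) / norm y + (xs \<bullet> z / norm z) * ((norm z - norm y) / norm y)"
  proof -
    have "norm y \<noteq> 0" "norm z \<noteq> 0" using y by auto
    then show ?thesis
      by (simp add: inner_diff_right field_simps)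
  qed
  also have "\<bar>\<dots>\<bar> \<le> norm (y - z) / norm y + 1 * (norm (y - z) / norm y)"
  proof (intro order_trans[OF abs_triangle_ineq] add_mono)
    show "\<bar>xs \<bullet> (y - z) / norm y\<bar> \<le> norm (y - z) / norm y"
      using Cauchy_Schwarz_ineq2[of xs "y - z"] xs by (simp add: abs_divide divide_right_mono)
    have "\<bar>xs \<bullet> z / norm z\<bar> \<le> 1"
      using y(2) by (auto simp: abs_divide divide_le_eq_1)
    moreover have "\<bar>(norm z - norm y) / norm y\<bar> \<le> norm (y - z) / norm y"
      using norm_triangle_ineq3[of z y] by (simp add: abs_divide divide_right_mono norm_minus_commute)
    ultimately show "\<bar>xs \<bullet> z / norm z * ((norm z - norm y) / norm y)\<bar> \<le> 1 * (norm (y - z) / norm y)"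
      unfolding abs_mult by (intro mult_mono) auto
  qed
  also have "\<dots> = 2 * (norm (y - z) / norm y)" by simp
  also have "\<dots> \<le> 2 * (norm (y - z) / (1 / 2))"
    using half by (intro mult_left_mono divide_left_mono) auto
  finally show ?thesis
    using sina by (simp add: field_simps)
qed

lemma GDERIV_along_curve:
  fixes f :: "real ^ 'n \<Rightarrow> real"
  assumes f: "GDERIV f (\<gamma> s) :> g" and \<gamma>: "(\<gamma> has_vector_derivative v) (at s)"
  shows "((\<lambda>s. f (\<gamma> s)) has_real_derivative v \<bullet> g) (at s)"
proof -
  have "((\<lambda>s. f (\<gamma> s)) has_derivative (\<lambda>r. (r *\<^sub>R v) \<bullet> g)) (at s)"
    using has_derivative_compose[OF \<gamma>[unfolded has_vector_derivative_def] f[unfolded gderiv_def]] .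
  moreover have "(\<lambda>r. (r *\<^sub>R v) \<bullet> g) = (*) (v \<bullet> g)"
    by (simp add: fun_eq_iff)
  ultimately show ?thesis
    by (simp add: has_field_derivative_def)
qed

section \<open>The loss near the unit sphere\<close>

text \<open>The data of the theorem, with angles \<open>a < b\<close> that will enclose the angle between the given point and \<open>xs\<close>.\<close>

locale loss_near =
  fixes xs :: "real ^ 'n" and t :: real and h :: "real \<Rightarrow> real" and a b :: real
  assumes xs: "norm xs = 1" and h: "h \<in> H_plus" and ab: "0 < a" "a < b" "b < pi / 2"
begin

text \<open>An open neighbourhood of the unit vectors whose angle with \<open>xs\<close> is between \<open>a\<close> and \<open>b\<close>. The conditions on the norm
are those of \<open>loss_kernel_majorised\<close>.\<close>

definition near :: "(real ^ 'n) set" where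
  "near = {y. \<bar>xs \<bullet> y\<bar> < norm y \<and> a < colat xs y \<and> colat xs y < b \<and> 1 / 2 < norm y \<and> (norm y)\<^sup>2 < 1 + (cot b)\<^sup>2}"

abbreviation "D \<equiv> loss_domain xs t h"
abbreviation "f \<equiv> loss xs t h"
abbreviation "meridian_point r e \<tau> \<equiv> r *\<^sub>R (cos \<tau> *\<^sub>R xs + sin \<tau> *\<^sub>R e)"

lemma nearD:
  assumes "y \<in> near"
  shows "\<bar>xs \<bullet> y\<bar> < norm y" "a \<le> colat xs y" "colat xs y \<le> b" "a < colat xs y" "colat xs y < b"
    "1 / 2 \<le> norm y" "0 < norm y" "(norm y)\<^sup>2 \<le> 1 + (cot b)\<^sup>2"
  using assms by (auto simp: near_def)

lemma eventually_near:
  assumes "y \<in> near"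
  shows "eventually (\<lambda>z. z \<in> near) (nhds y)"
proof -
  have y: "\<bar>xs \<bullet> y\<bar> < norm y" using assms by (simp add: near_def)
  have c: "isCont (colat xs) y" by (rule isCont_polar(1)[OF xs y])
  have lim: "((\<lambda>z. z) \<longlongrightarrow> y) (nhds y)" "(colat xs \<longlongrightarrow> colat xs y) (nhds y)"
    using c by (auto simp: isCont_def tendsto_at_iff_tendsto_nhds filterlim_ident)
  have less: "eventually (\<lambda>z. p z < q z) (nhds y)"
    if "(p \<longlongrightarrow> p y) (nhds y)" "(q \<longlongrightarrow> q y) (nhds y)" "p y < q y" for p q :: "real^'n \<Rightarrow> real"
    using order_tendstoD(1)[OF tendsto_diff[OF that(2,1)], of 0] that(3) by simp
  show ?thesis
    unfolding near_def mem_Collect_eq using assms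
    by (intro eventually_conj less) (auto intro!: tendsto_intros lim simp: near_def)
qed

lemma open_near: "open near"
proof (rule Topological_Spaces.openI)
  fix y assume "y \<in> near"
  then obtain S where "open S" "y \<in> S" "\<forall>z\<in>S. z \<in> near"
    using eventually_near by (auto simp: eventually_nhds)
  then show "\<exists>T. open T \<and> y \<in> T \<and> T \<subseteq> near"
    by (intro exI[of _ S]) auto
qed

lemma in_domain_iff:
  assumes "norm e = 1" "xs \<bullet> e = 0" "0 < r" "0 < sin \<theta>"
  shows "meridian_point r e \<theta> \<in> D \<longleftrightarrow> integrable lborel (loss_kernel (\<lambda>v. \<bar>h v\<bar>) t r \<theta>)"
    and "meridian_point r e \<theta> \<in> D \<Longrightarrow> f (meridian_point r e \<theta>) = (\<integral>v. loss_kernel h t r \<theta> v \<partial>lborel)"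
  using loss_polar[OF xs assms H_plus_measurable[OF h] refl, of t] by auto

lemma near_domain:
  assumes y: "y \<in> near"
  shows "y \<in> D \<longleftrightarrow> integrable lborel (loss_kernel (\<lambda>v. \<bar>h v\<bar>) t (norm y) (colat xs y))"
    and "y \<in> D \<Longrightarrow> f y = (\<integral>v. loss_kernel h t (norm y) (colat xs y) v \<partial>lborel)"
proof -
  note p = polar_coordinates[OF xs nearD(1)[OF y]]
  have s: "0 < sin (colat xs y)"
    using p by (intro sin_gt_zero) auto
  show "y \<in> D \<longleftrightarrow> integrable lborel (loss_kernel (\<lambda>v. \<bar>h v\<bar>) t (norm y) (colat xs y))"
    using in_domain_iff(1)[OF p(1,2) nearD(7)[OF y] s] p(6) by simp
  show "f y = (\<integral>v. loss_kernel h t (norm y) (colat xs y) v \<partial>lborel)" if "y \<in> D"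
    using in_domain_iff(2)[OF p(1,2) nearD(7)[OF y] s] p(6) that by simp
qed

lemma loss_family_1: "loss_family h t a b 1"
  using ab H_plus_measurable[OF h] H_plus_integrable[OF h] far_integrable_1
  by unfold_locales auto

lemma loss_family_if:
  assumes y: "y \<in> near" "y \<in> D" and \<rho>: "1 \<le> \<rho>" "\<rho> < norm y"
  shows "loss_family h t a b \<rho>"
proof -
  have "far_integrable h t \<rho>"
  proof (rule far_integrable_of_loss_kernel[where a=a and \<theta>="colat xs y" and r="norm y"])
    show "integrable lborel (loss_kernel (\<lambda>v. \<bar>h v\<bar>) t (norm y) (colat xs y))"
      using near_domain(1) y by blast
  qed (use ab nearD[OF y(1)] \<rho> H_plus_measurable[OF h] in auto)
  moreover have "\<rho>\<^sup>2 \<le> 1 + (cot b)\<^sup>2"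
    using power_mono[of \<rho> "norm y" 2] \<rho> nearD(8)[OF y(1)] by linarith
  ultimately show ?thesis
    using ab H_plus_measurable[OF h] H_plus_integrable[OF h] \<rho>
    by unfold_locales auto
qed

lemma domain_if_loss_family:
  assumes "loss_family h t a b \<rho>" "y \<in> near" "norm y \<le> \<rho>"
  shows "y \<in> D"
  using loss_family.integrable_loss_kernel(2)[OF assms(1) nearD(6)[OF assms(2)] assms(3) nearD(2,3)[OF assms(2)]]
    near_domain(1)[OF assms(2)] by simp

text \<open>The unit ball near \<open>x\<close> belongs to the domain, and \<open>x\<close> is approached from inside along its ray.\<close>

lemma mem_closure_interior_domain:
  assumes x: "x \<in> near" "norm x = 1"
  shows "x \<in> D \<inter> closure (interior D)"
proof -
  have sub: "near \<inter> ball 0 1 \<subseteq> interior D"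
    using domain_if_loss_family[OF loss_family_1]
    by (intro interior_maximal open_Int open_near) auto
  have "\<exists>y\<in>interior D. dist y x < e" if e: "e > 0" for e
  proof -
    obtain d where d: "d > 0" "ball x d \<subseteq> near"
      using open_near x(1) openE by blast
    define s where "s = min (min d e) 1 / 2"
    have s: "0 < s" "s < d" "s < e" "s < 1"
      using d(1) e by (auto simp: s_def)
    have eq: "(1 - s) *\<^sub>R x - x = - (s *\<^sub>R x)" by (simp add: algebra_simps)
    have dist: "dist ((1 - s) *\<^sub>R x) x = s"
      unfolding dist_norm eq using s x by simp
    then have "(1 - s) *\<^sub>R x \<in> near \<inter> ball 0 1"
      using d(2) s x by (auto simp: dist_commute)
    then show ?thesis
      using sub dist s by (intro bexI[of _ "(1 - s) *\<^sub>R x"]) auto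
  qed
  then have "x \<in> closure (interior D)"
    by (simp add: closure_approachable)
  moreover have "x \<in> D"
    using domain_if_loss_family[OF loss_family_1 x(1)] x(2) by simp
  ultimately show ?thesis by simp
qed

text \<open>If the domain has a point of norm greater than 1 near \<open>x\<close>, then all points of slightly larger norm than \<open>x\<close>
are covered by some \<open>\<rho> > 1\<close>; otherwise \<open>\<rho> = 1\<close> covers the domain near \<open>x\<close>.\<close>

lemma locally_lipschitz_loss:
  assumes x: "x \<in> near" "norm x = 1"
  shows "locally_lipschitz_at D f x"
proof -
  obtain d where d: "d > 0" "ball x d \<subseteq> near"
    using open_near x(1) openE by blast
  have "\<exists>\<rho> \<epsilon>. loss_family h t a b \<rho> \<and> 0 < \<epsilon> \<and> \<epsilon> \<le> d \<and> (\<forall>y\<in>D \<inter> ball x \<epsilon>. norm y \<le> \<rho>)"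
  proof (cases "\<exists>y\<in>D \<inter> ball x d. 1 < norm y")
    case True
    then obtain y where y: "y \<in> D" "y \<in> ball x d" "1 < norm y" by auto
    define \<rho> where "\<rho> = (1 + norm y) / 2"
    have \<rho>: "1 < \<rho>" "\<rho> < norm y" using y by (auto simp: \<rho>_def)
    have "norm z \<le> \<rho>" if "z \<in> ball x (min d (\<rho> - 1))" for z
    proof -
      have "norm (z - x) < \<rho> - 1"
        using that by (simp add: dist_norm norm_minus_commute)
      then show ?thesis
        using norm_triangle_ineq2[of z x] x by linarith
    qed
    moreover have "loss_family h t a b \<rho>"
      using y d \<rho> by (intro loss_family_if[of y]) auto
    ultimately show ?thesis
      using d \<rho> by (intro exI[of _ \<rho>] exI[of _ "min d (\<rho> - 1)"]) auto
  next
    case False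
    then show ?thesis
      using loss_family_1 d by (intro exI[of _ 1] exI[of _ d]) (auto simp: not_less)
  qed
  then obtain \<rho> \<epsilon> where fam: "loss_family h t a b \<rho>" and \<epsilon>: "0 < \<epsilon>" "\<epsilon> \<le> d"
    and le: "\<And>y. y \<in> D \<inter> ball x \<epsilon> \<Longrightarrow> norm y \<le> \<rho>" by blast
  obtain L where L0: "L \<ge> 0" and L: "\<forall>r \<theta> r' \<theta>'. 1 / 2 \<le> r \<longrightarrow> r \<le> \<rho> \<longrightarrow> a \<le> \<theta> \<longrightarrow> \<theta> \<le> b \<longrightarrow>
     1 / 2 \<le> r' \<longrightarrow> r' \<le> \<rho> \<longrightarrow> a \<le> \<theta>' \<longrightarrow> \<theta>' \<le> b \<longrightarrow>
     \<bar>(\<integral>v. loss_kernel h t r \<theta> v \<partial>lborel) - (\<integral>v. loss_kernel h t r' \<theta>' v \<partial>lborel)\<bar> \<le> L * (\<bar>r - r'\<bar> + \<bar>\<theta> - \<theta>'\<bar>)"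
    using loss_family.lipschitz_integral[OF fam] by blast
  have sina: "0 < sin a" using ab by (intro sin_gt_zero) auto
  have "(L * (1 + 4 / sin a))-lipschitz_on (D \<inter> ball x \<epsilon>) f"
  proof (rule lipschitz_onI)
    show "0 \<le> L * (1 + 4 / sin a)" using L0 sina by simp
    fix y z assume yz: "y \<in> D \<inter> ball x \<epsilon>" "z \<in> D \<inter> ball x \<epsilon>"
    then have n: "y \<in> near" "z \<in> near" using d \<epsilon> by auto
    have "\<bar>f y - f z\<bar> \<le> L * (\<bar>norm y - norm z\<bar> + \<bar>colat xs y - colat xs z\<bar>)"
      using L[rule_format, OF nearD(6)[OF n(1)] le[OF yz(1)] nearD(2,3)[OF n(1)] nearD(6)[OF n(2)] le[OF yz(2)] nearD(2,3)[OF n(2)]]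
        near_domain(2)[OF n(1)] near_domain(2)[OF n(2)] yz by simp
    also have "\<dots> \<le> L * (norm (y - z) + 4 / sin a * norm (y - z))"
    proof (intro mult_left_mono add_mono L0)
      show "\<bar>colat xs y - colat xs z\<bar> \<le> 4 / sin a * norm (y - z)"
        using nearD[OF n(1)] nearD[OF n(2)] ab by (intro colat_lipschitz[where b=b] xs) auto
    qed (rule norm_triangle_ineq3)
    finally show "dist (f y) (f z) \<le> L * (1 + 4 / sin a) * dist y z"
      by (simp add: dist_norm algebra_simps)
  qed
  then show ?thesis
    using \<epsilon>(1) unfolding locally_lipschitz_at_def by blast
qed

text \<open>For \<open>w\<close> orthogonal to \<open>xs\<close> and \<open>y\<close>, the points \<open>y + s w\<close> and \<open>y - s w\<close> have the same norm and the same
colatitude. So the loss is even along this line, and its derivative in the direction \<open>w\<close> vanishes. This applies to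
the component \<open>w\<close> of the gradient orthogonal to the plane.\<close>

lemma gradient_in_meridian_plane:
  assumes y: "y \<in> near" "y \<in> interior D" and g: "GDERIV f y :> g"
  shows "g = (g \<bullet> xs) *\<^sub>R xs + (g \<bullet> meridian xs y) *\<^sub>R meridian xs y"
proof -
  let ?e = "meridian xs y"
  note p = polar_coordinates[OF xs nearD(1)[OF y(1)]]
  define w where "w = g - (g \<bullet> xs) *\<^sub>R xs - (g \<bullet> ?e) *\<^sub>R ?e"
  have wx: "w \<bullet> xs = 0" "w \<bullet> ?e = 0"
    using p(1,2) xs by (auto simp: w_def inner_diff_left norm_eq_1 inner_commute[of ?e xs])
  then have wy: "w \<bullet> y = 0"
    by (subst p(6)) (simp add: inner_add_right)
  have gw: "w \<bullet> g = w \<bullet> w"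
  proof -
    have "w \<bullet> w = w \<bullet> (g - (g \<bullet> xs) *\<^sub>R xs - (g \<bullet> ?e) *\<^sub>R ?e)" by (simp only: w_def)
    also have "\<dots> = w \<bullet> g" by (simp add: inner_diff_right wx)
    finally show ?thesis ..
  qed
  have d1: "((\<lambda>s. f (y + s *\<^sub>R w)) has_real_derivative w \<bullet> g) (at 0)"
    using g by (intro GDERIV_along_curve) (auto intro!: derivative_eq_intros)
  have d2: "((\<lambda>s. f (y + s *\<^sub>R (- w))) has_real_derivative (- w) \<bullet> g) (at 0)"
    using g by (intro GDERIV_along_curve) (auto intro!: derivative_eq_intros)
  define U where "U = (\<lambda>s::real. y + s *\<^sub>R w) -` (near \<inter> interior D) \<inter> (\<lambda>s. y + s *\<^sub>R (- w)) -` (near \<inter> interior D)"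
  have "open U"
    unfolding U_def using open_near
    by (intro open_Int open_vimage continuous_intros) auto
  moreover have "0 \<in> U"
    using y by (simp add: U_def)
  moreover have "f (y + s *\<^sub>R w) = f (y + s *\<^sub>R (- w))" if "s \<in> U" for s
  proof -
    have n: "y + s *\<^sub>R w \<in> near" "y + s *\<^sub>R (- w) \<in> near" and dm: "y + s *\<^sub>R w \<in> D" "y + s *\<^sub>R (- w) \<in> D"
      using that interior_subset[of D] by (auto simp: U_def)
    have nn: "norm (y + s *\<^sub>R w) = norm (y + s *\<^sub>R (- w))"
      using wy by (simp add: norm_eq inner_add_left inner_add_right inner_diff_left inner_diff_right inner_commute[of y w])
    moreover have "colat xs (y + s *\<^sub>R w) = colat xs (y + s *\<^sub>R (- w))"
      unfolding colat_def nn using wx by (simp add: inner_add_right inner_diff_right inner_commute[of xs w])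
    ultimately show ?thesis
      unfolding near_domain(2)[OF n(1) dm(1)] near_domain(2)[OF n(2) dm(2)] by simp
  qed
  ultimately have "((\<lambda>s. f (y + s *\<^sub>R (- w))) has_real_derivative w \<bullet> g) (at 0)"
    by (rule has_field_derivative_transform_within_open[OF d1])
  then have "w \<bullet> g = (- w) \<bullet> g"
    using d2 by (rule DERIV_unique)
  then have "w = 0"
    using gw by simp
  then have "g - ((g \<bullet> xs) *\<^sub>R xs + (g \<bullet> ?e) *\<^sub>R ?e) = 0"
    by (simp add: w_def diff_diff_eq)
  then show ?thesis
    by (rule eq_iff_diff_eq_0[THEN iffD2])
qed

text \<open>The derivative of the loss along the meridian through \<open>y\<close>, at constant norm, is the angular derivative of the
integrated kernel.\<close>

lemma gradient_along_meridian:
  assumes y: "y \<in> near" "y \<in> interior D" and g: "GDERIV f y :> g"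
  shows "norm y * (g \<bullet> (cos (colat xs y) *\<^sub>R meridian xs y - sin (colat xs y) *\<^sub>R xs))
      = (\<integral>v. loss_kernel_angle_deriv h t (norm y) (colat xs y) v \<partial>lborel)"
    and "integrable lborel (loss_kernel_angle_deriv h t (norm y) (colat xs y))"
proof -
  let ?e = "meridian xs y" and ?\<theta> = "colat xs y" and ?r = "norm y"
  note p = polar_coordinates[OF xs nearD(1)[OF y(1)]]
  have r: "0 < ?r" using nearD[OF y(1)] by simp
  \<comment> \<open>For norms above 1, a point of the domain slightly farther out on the same ray gives integrability.\<close>
  have "\<exists>\<rho>. loss_family h t a b \<rho> \<and> ?r \<le> \<rho>"
  proof (cases "?r \<le> 1")
    case True
    then show ?thesis using loss_family_1 by blast
  next
    case False
    have "open (near \<inter> interior D)" using open_near by auto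
    then obtain d where d: "d > 0" "ball y d \<subseteq> near \<inter> interior D"
      using y openE by blast
    define z where "z = (1 + d / (2 * ?r)) *\<^sub>R y"
    have "z - y = (d / (2 * ?r)) *\<^sub>R y" by (simp add: z_def algebra_simps)
    then have "dist z y = d / 2"
      unfolding dist_norm using r d by simp
    then have "z \<in> near" "z \<in> D"
      using d interior_subset[of D] by (auto simp: dist_commute subset_eq)
    moreover have "?r < norm z"
      using r d by (simp add: z_def)
    ultimately have "loss_family h t a b ?r"
      using False by (intro loss_family_if[of z]) auto
    then show ?thesis by blast
  qed
  then obtain \<rho> where fam: "loss_family h t a b \<rho>" and r_le: "?r \<le> \<rho>" by blast
  interpret loss_family h t a b \<rho> by (rule fam)
  show "integrable lborel (loss_kernel_angle_deriv h t ?r ?\<theta>)"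
    using nearD[OF y(1)] r_le by (intro integrable_loss_kernel) auto
  have dF: "((\<lambda>\<tau>. \<integral>v. loss_kernel h t ?r \<tau> v \<partial>lborel) has_real_derivative
      (\<integral>v. loss_kernel_angle_deriv h t ?r ?\<theta> v \<partial>lborel)) (at ?\<theta>)"
    using nearD[OF y(1)] r_le by (intro DERIV_integral_angle) auto
  have g': "GDERIV f (meridian_point ?r ?e ?\<theta>) :> g"
    using g p(6) by simp
  have curve: "(meridian_point ?r ?e has_vector_derivative ?r *\<^sub>R (cos ?\<theta> *\<^sub>R ?e - sin ?\<theta> *\<^sub>R xs)) (at ?\<theta>)"
    by (auto intro!: derivative_eq_intros simp: algebra_simps)
  have dG: "((\<lambda>\<tau>. f (meridian_point ?r ?e \<tau>)) has_real_derivative (?r *\<^sub>R (cos ?\<theta> *\<^sub>R ?e - sin ?\<theta> *\<^sub>R xs)) \<bullet> g) (at ?\<theta>)"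
    by (rule GDERIV_along_curve[OF g' curve])
  define U where "U = meridian_point ?r ?e -` interior D \<inter> {0<..<pi}"
  have "open U"
    unfolding U_def by (intro open_Int open_vimage continuous_intros) auto
  moreover have "?\<theta> \<in> U"
    using p y(2) by (simp add: U_def flip: p(6))
  moreover have "f (meridian_point ?r ?e \<tau>) = (\<integral>v. loss_kernel h t ?r \<tau> v \<partial>lborel)" if "\<tau> \<in> U" for \<tau>
    using that interior_subset[of D] p(1,2) r
    by (intro in_domain_iff(2)) (auto simp: U_def intro: sin_gt_zero)
  ultimately have "((\<lambda>\<tau>. \<integral>v. loss_kernel h t ?r \<tau> v \<partial>lborel) has_real_derivative
      (?r *\<^sub>R (cos ?\<theta> *\<^sub>R ?e - sin ?\<theta> *\<^sub>R xs)) \<bullet> g) (at ?\<theta>)"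
    by (rule has_field_derivative_transform_within_open[OF dG])
  then have "(?r *\<^sub>R (cos ?\<theta> *\<^sub>R ?e - sin ?\<theta> *\<^sub>R xs)) \<bullet> g = (\<integral>v. loss_kernel_angle_deriv h t ?r ?\<theta> v \<partial>lborel)"
    using dF by (rule DERIV_unique)
  then show "?r * (g \<bullet> (cos ?\<theta> *\<^sub>R ?e - sin ?\<theta> *\<^sub>R xs)) = (\<integral>v. loss_kernel_angle_deriv h t ?r ?\<theta> v \<partial>lborel)"
    by (simp add: inner_commute)
qed

text \<open>The two conditions define a convex set, which contains all limits of gradients since the lower bound for the
angular derivative is uniform near \<open>x\<close>.\<close>

lemma clarke_subgradient:
  assumes x: "x \<in> near" "norm x = 1"
  shows "\<exists>\<delta>>0. \<forall>\<xi>\<in>clarke_subdifferential D f x.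
      \<xi> = (\<xi> \<bullet> xs) *\<^sub>R xs + (\<xi> \<bullet> meridian xs x) *\<^sub>R meridian xs x \<and>
      \<delta> \<le> \<xi> \<bullet> (cos (colat xs x) *\<^sub>R meridian xs x - sin (colat xs x) *\<^sub>R xs)"
proof -
  let ?e = "meridian xs x" and ?\<theta> = "colat xs x"
  note p = polar_coordinates[OF xs nearD(1)[OF x(1)]]
  define n where "n = (\<lambda>y. cos (colat xs y) *\<^sub>R meridian xs y - sin (colat xs y) *\<^sub>R xs)"
  define a0 where "a0 = sin ?\<theta>"
  define b0 where "b0 = t * (1 - cos ?\<theta>)"
  define H where "H = (\<lambda>u. h u - h (- u))"
  define \<delta> where "\<delta> = std_normal_density t * ((H (b0 + a0 / 2) - H (b0 + a0 / 4)) * std_normal_density 2)"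
  have H: "strict_mono H"
    unfolding H_def by (rule H_plus_odd_part_strict_mono[OF h])
  have a0: "0 < a0" unfolding a0_def using p by (intro sin_gt_zero) auto
  have \<delta>: "0 < \<delta>"
    unfolding \<delta>_def using strict_monoD[OF H, of "b0 + a0 / 4" "b0 + a0 / 2"] a0
    by (intro mult_pos_pos normal_density_pos) auto
  define S where "S = {\<xi>. \<xi> = (\<xi> \<bullet> xs) *\<^sub>R xs + (\<xi> \<bullet> ?e) *\<^sub>R ?e \<and> \<delta> \<le> \<xi> \<bullet> n x}"
  have "convex S"
  proof (rule convexI)
    fix u v :: "real ^ 'n" and \<mu> \<nu> :: real
    assume uv: "u \<in> S" "v \<in> S" and w: "0 \<le> \<mu>" "0 \<le> \<nu>" "\<mu> + \<nu> = 1"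
    have "\<mu> *\<^sub>R u + \<nu> *\<^sub>R v
        = \<mu> *\<^sub>R ((u \<bullet> xs) *\<^sub>R xs + (u \<bullet> ?e) *\<^sub>R ?e) + \<nu> *\<^sub>R ((v \<bullet> xs) *\<^sub>R xs + (v \<bullet> ?e) *\<^sub>R ?e)"
      using uv by (simp add: S_def)
    also have "\<dots> = ((\<mu> *\<^sub>R u + \<nu> *\<^sub>R v) \<bullet> xs) *\<^sub>R xs + ((\<mu> *\<^sub>R u + \<nu> *\<^sub>R v) \<bullet> ?e) *\<^sub>R ?e"
      by (simp add: inner_add_left algebra_simps)
    finally have "\<mu> *\<^sub>R u + \<nu> *\<^sub>R v
        = ((\<mu> *\<^sub>R u + \<nu> *\<^sub>R v) \<bullet> xs) *\<^sub>R xs + ((\<mu> *\<^sub>R u + \<nu> *\<^sub>R v) \<bullet> ?e) *\<^sub>R ?e" .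
    moreover have "\<delta> \<le> (\<mu> *\<^sub>R u + \<nu> *\<^sub>R v) \<bullet> n x"
    proof -
      have "\<mu> * \<delta> + \<nu> * \<delta> \<le> \<mu> * (u \<bullet> n x) + \<nu> * (v \<bullet> n x)"
        using uv w by (intro add_mono mult_left_mono) (auto simp: S_def)
      moreover have "\<mu> * \<delta> + \<nu> * \<delta> = \<delta>"
        using w(3) by (metis distrib_right mult_1)
      ultimately show ?thesis by (simp add: inner_add_left)
    qed
    ultimately show "\<mu> *\<^sub>R u + \<nu> *\<^sub>R v \<in> S"
      unfolding S_def by blast
  qed
  moreover have "{\<xi>. \<exists>y g. (\<forall>k::nat. y k \<in> interior D \<and> GDERIV f (y k) :> g k) \<and> y \<longlonglongrightarrow> x \<and> g \<longlonglongrightarrow> \<xi>} \<subseteq> S"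
  proof clarify
    fix \<xi> y g
    assume yg: "\<forall>k::nat. y k \<in> interior D \<and> GDERIV f (y k) :> g k" and y: "y \<longlonglongrightarrow> x" and g: "g \<longlonglongrightarrow> \<xi>"
    have col: "(\<lambda>k. colat xs (y k)) \<longlonglongrightarrow> ?\<theta>" and mer: "(\<lambda>k. meridian xs (y k)) \<longlonglongrightarrow> ?e"
      using isCont_polar[OF xs nearD(1)[OF x(1)]] y by (auto intro: isCont_tendsto_compose)
    have nlim: "(\<lambda>k. n (y k)) \<longlonglongrightarrow> n x"
      unfolding n_def by (intro tendsto_intros col mer)
    have nr: "(\<lambda>k. norm (y k)) \<longlonglongrightarrow> 1"
      using tendsto_norm[OF y] x(2) by simp
    have near: "eventually (\<lambda>k. y k \<in> near) sequentially"
      using topological_tendstoD[OF y open_near x(1)] .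
    have "eventually (\<lambda>k. (g k \<bullet> xs) *\<^sub>R xs + (g k \<bullet> meridian xs (y k)) *\<^sub>R meridian xs (y k) = g k) sequentially"
      using near by eventually_elim (use yg gradient_in_meridian_plane in metis)
    moreover have "(\<lambda>k. (g k \<bullet> xs) *\<^sub>R xs + (g k \<bullet> meridian xs (y k)) *\<^sub>R meridian xs (y k))
        \<longlonglongrightarrow> (\<xi> \<bullet> xs) *\<^sub>R xs + (\<xi> \<bullet> ?e) *\<^sub>R ?e"
      by (intro tendsto_intros g mer)
    ultimately have "g \<longlonglongrightarrow> (\<xi> \<bullet> xs) *\<^sub>R xs + (\<xi> \<bullet> ?e) *\<^sub>R ?e"
      by (rule Lim_transform_eventually[rotated])
    then have plane: "\<xi> = (\<xi> \<bullet> xs) *\<^sub>R xs + (\<xi> \<bullet> ?e) *\<^sub>R ?e"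
      using g by (rule LIMSEQ_unique[rotated])
    have "(\<lambda>k. norm (y k) * sin (colat xs (y k))) \<longlonglongrightarrow> 1 * sin ?\<theta>"
      by (intro tendsto_intros nr col)
    then have ea: "eventually (\<lambda>k. dist (norm (y k) * sin (colat xs (y k))) a0 < a0 / 4) sequentially"
      using a0 by (intro tendstoD) (auto simp: a0_def)
    have "(\<lambda>k. t * (1 - norm (y k) * cos (colat xs (y k)))) \<longlonglongrightarrow> t * (1 - 1 * cos ?\<theta>)"
      by (intro tendsto_intros nr col)
    then have eb: "eventually (\<lambda>k. dist (t * (1 - norm (y k) * cos (colat xs (y k)))) b0 < a0 / 4) sequentially"
      using a0 by (intro tendstoD) (auto simp: b0_def)
    have "eventually (\<lambda>k. \<delta> \<le> norm (y k) * (g k \<bullet> n (y k))) sequentially"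
      using near ea eb
    proof eventually_elim
      case (elim k)
      let ?r = "norm (y k)" and ?\<tau> = "colat xs (y k)"
      have gk: "y k \<in> interior D" "GDERIV f (y k) :> g k" using yg by auto
      have r: "0 < ?r" and s: "0 < sin ?\<tau>"
        using nearD[OF elim(1)] ab by (auto intro: sin_gt_zero)
      note eq = integral_angle_deriv_eq[OF H_plus_measurable[OF h] r s, of t, folded H_def]
      have "integrable lborel (\<lambda>w. H (?r * sin ?\<tau> * w + t * (1 - ?r * cos ?\<tau>)) * (std_normal_density w * w))"
        using gradient_along_meridian(2)[OF elim(1) gk] eq(1) by (simp add: H_def)
      then have "(H (b0 + a0 / 2) - H (b0 + a0 / 4)) * std_normal_density 2
          \<le> (\<integral>w. H (?r * sin ?\<tau> * w + t * (1 - ?r * cos ?\<tau>)) * (std_normal_density w * w) \<partial>lborel)"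
        using elim by (intro integral_mult_normal_ge[OF H a0]) (auto simp: dist_real_def)
      then have "\<delta> \<le> (\<integral>v. loss_kernel_angle_deriv h t ?r ?\<tau> v \<partial>lborel)"
        unfolding \<delta>_def eq(2) by (intro mult_left_mono) (auto simp: H_def)
      then show "\<delta> \<le> ?r * (g k \<bullet> n (y k))"
        unfolding n_def gradient_along_meridian(1)[OF elim(1) gk] .
    qed
    moreover have "(\<lambda>k. norm (y k) * (g k \<bullet> n (y k))) \<longlonglongrightarrow> 1 * (\<xi> \<bullet> n x)"
      by (intro tendsto_intros nr g nlim)
    ultimately have "\<delta> \<le> 1 * (\<xi> \<bullet> n x)"
      by (intro tendsto_lowerbound[of _ _ sequentially]) auto
    then show "\<xi> \<in> S"
      using plane by (simp add: S_def)
  qed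
  ultimately have "clarke_subdifferential D f x \<subseteq> S"
    unfolding clarke_subdifferential_def by (intro hull_minimal)
  then show ?thesis
    using \<delta> unfolding S_def n_def by blast
qed

end

section \<open>Riemannian gradient alignment\<close>

theorem corollary5p8:
  fixes xs x :: "real ^ 'n" and t :: real and h :: "real \<Rightarrow> real"
  assumes "xs \<in> sphere 0 1"
    and "h \<in> H_plus"
    and "x \<in> sphere 0 1"
    and "angle x xs \<in> {0<..<pi / 2}"
  shows "rga 1 (loss_domain xs t h) (loss xs t h) x xs"
proof -
  define \<theta> where "\<theta> = angle x xs"
  have th: "0 < \<theta>" "\<theta> < pi / 2" using assms(4) by (auto simp: \<theta>_def)
  have n1: "norm xs = 1" "norm x = 1" using assms by auto
  have col: "colat xs x = \<theta>"
    using n1 by (simp add: \<theta>_def angle_def colat_def inner_commute)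
  define a where "a = \<theta> / 2"
  define b where "b = (\<theta> + pi / 2) / 2"
  have ab_th: "0 < a" "a < b" "b < pi / 2" "a < \<theta>" "\<theta> < b"
    using th by (auto simp: a_def b_def)
  interpret loss_near xs t h a b
    using n1 assms(2) ab_th by unfold_locales auto
  have le: "\<bar>xs \<bullet> x\<bar> \<le> 1"
    using Cauchy_Schwarz_ineq2[of xs x] n1 by simp
  \<comment> \<open>\<open>arccos 1 = 0\<close> and \<open>arccos (- 1) = pi\<close> are excluded, so \<open>x\<close> is not parallel to \<open>xs\<close>.\<close>
  have ne: "xs \<bullet> x \<noteq> 1" "xs \<bullet> x \<noteq> - 1"
    using th by (auto simp: \<theta>_def angle_def inner_commute[of x xs])
  have lt: "\<bar>xs \<bullet> x\<bar> < norm x"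
    using le ne n1 by auto
  have "0 < cot b"
    using ab_th by (auto simp: cot_def intro!: divide_pos_pos sin_gt_zero cos_gt_zero)
  then have near: "x \<in> near"
    unfolding near_def using lt ab_th n1 by (simp add: col)
  define e where "e = meridian xs x"
  note p = polar_coordinates[OF n1(1) lt]
  have x_eq: "x = cos \<theta> *\<^sub>R xs + sin \<theta> *\<^sub>R e"
    using p(6) n1 by (simp add: col e_def)
  define n where "n = cos \<theta> *\<^sub>R e - sin \<theta> *\<^sub>R xs"
  have on: "xs \<bullet> xs = 1" "e \<bullet> e = 1" "xs \<bullet> e = 0" "e \<bullet> xs = 0"
    using n1 p(1,2) by (auto simp: norm_eq_1 inner_commute e_def)
  have nn: "norm n = 1"
    by (simp add: norm_eq_1 n_def inner_diff_left inner_diff_right on flip: power2_eq_square)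
  obtain \<delta> where \<delta>: "\<delta> > 0" "\<And>\<xi>. \<xi> \<in> clarke_subdifferential D f x \<Longrightarrow>
      \<xi> = (\<xi> \<bullet> xs) *\<^sub>R xs + (\<xi> \<bullet> e) *\<^sub>R e \<and> \<delta> \<le> \<xi> \<bullet> n"
    using clarke_subgradient[OF near n1(2)] unfolding n_def e_def col by blast
  have "(x \<noteq> xs \<longrightarrow> g \<noteq> 0) \<and> g \<bullet> xs \<le> - 1 * sin (angle x xs) * norm g"
    if "g \<in> riemannian_clarke_subdifferential D f x" for g
  proof -
    obtain \<xi> where \<xi>: "\<xi> \<in> clarke_subdifferential D f x" and g: "g = \<xi> - (x \<bullet> \<xi>) *\<^sub>R x"
      using \<open>g \<in> _\<close> by (auto simp: riemannian_clarke_subdifferential_def)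
    define u where "u = \<xi> \<bullet> xs"
    define v where "v = \<xi> \<bullet> e"
    define l where "l = \<xi> \<bullet> n"
    have \<xi>_eq: "\<xi> = u *\<^sub>R xs + v *\<^sub>R e" and l0: "0 < l"
      using \<delta>(1) \<delta>(2)[OF \<xi>] by (auto simp: u_def v_def l_def)
    have l: "l = cos \<theta> * v - sin \<theta> * u"
      by (simp add: l_def n_def u_def v_def inner_diff_right)
    have sc: "(cos \<theta>)\<^sup>2 + (sin \<theta>)\<^sup>2 = 1" by simp
    have xxi: "x \<bullet> \<xi> = cos \<theta> * u + sin \<theta> * v"
      by (simp add: x_eq \<xi>_eq inner_add_left inner_add_right on)
    \<comment> \<open>The tangential projection of \<open>\<xi>\<close> is \<open>l n\<close>, as \<open>x\<close> and \<open>n\<close> are an orthonormal basis of the plane.\<close>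
    have c1: "u - (cos \<theta> * u + sin \<theta> * v) * cos \<theta> = - l * sin \<theta>"
      and c2: "v - (cos \<theta> * u + sin \<theta> * v) * sin \<theta> = l * cos \<theta>"
      using sc unfolding l by algebra+
    have "g = (u - (cos \<theta> * u + sin \<theta> * v) * cos \<theta>) *\<^sub>R xs + (v - (cos \<theta> * u + sin \<theta> * v) * sin \<theta>) *\<^sub>R e"
      unfolding g xxi by (subst x_eq, subst \<xi>_eq) (simp add: algebra_simps)
    also have "\<dots> = l *\<^sub>R n"
      unfolding c1 c2 n_def by (simp add: algebra_simps)
    finally have gn: "g = l *\<^sub>R n" .
    have "norm g = l" using gn nn l0 by simp
    moreover have "g \<bullet> xs = - (l * sin \<theta>)"
      by (simp add: gn n_def inner_diff_left on)
    ultimately show ?thesis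
      using l0 by (auto simp: \<theta>_def)
  qed
  then show ?thesis
    unfolding rga_def using mem_closure_interior_domain[OF near n1(2)] locally_lipschitz_loss[OF near n1(2)] by blast
qed

end
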